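(* Let $d\ge1$, let $V$ and $W$ be finite-dimensional real inner product spaces, and let $A\in L(V,W)$ be a linear map. Then for every $\mathbf{x}\in\mathrm{Lip}_J(\square^d,V)$, $$\Phi(A\mathbf{x})=\mathbf{A}\,\Phi(\mathbf{x}),$$ where $\mathbf{A}:\mathbf{H}_d((V))\to\mathbf{H}_d((W))$ is the linear map induced by $A$.
   Context: Notation: $\square^d=[0,1]^d$, $[k]=\{1,\dots,k\}$, $\Sigma_m$ is the symmetric group on $[m]$. For a finite-dimensional real inner product space $E$ and a Lipschitz map $\mathbf{x}:\square^d\to E$ (differentiable a.e.), $\hat d\mathbf{x}(\mathbf{s})=\frac{\partial\mathbf{x}}{\partial s_1}(\mathbf{s})\wedge\dots\wedge\frac{\partial\mathbf{x}}{\partial s_d}(\mathbf{s})$, so $\hat d\mathbf{x}\in L^\infty(\square^d,\Lambda^dE)$. Lipschitz maps are Jacobian equivalent if $\hat d\mathbf{x}=\hat d\mathbf{y}$ in $L^\infty$; $\mathrm{Lip}_J(\square^d,E)$ is the set of equivalence classes. A linear map $A:V\to W$ induces $A:\mathrm{Lip}_J(\square^d,V)\to\mathrm{Lip}_J(\square^d,W)$, $[\mathbf{x}]\mapsto[A\circ\mathbf{x}]$. For $\pi\in\Sigma_m$, $\Delta^m_\pi=\{0\le t_{\pi(1)}<\dots<t_{\pi(m)}\le1\}$. For $\boldsymbol\pi=(\pi_1,\dots,\pi_d)\in\Sigma_m^d$, $D^m_{\boldsymbol\pi}=\prod_{j=1}^d\Delta^m_{\pi_j}$, with coordinates $\mathbf{t}=(t_{i,j})_{i\in[m],j\in[d]}$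 such that $(t_{1,j},\dots,t_{m,j})\in\Delta^m_{\pi_j}$, and $\mathbf{t}_i=(t_{i,1},\dots,t_{i,d})$. Let $\mathbf{T}_d^{(0)}(E)=\mathbb{R}$ and $\mathbf{T}_d^{(m)}(E)=\prod_{\boldsymbol\pi\in\Sigma_m^d}(\Lambda^dE)^{\otimes m}$ for $m\ge1$, with the natural inner products, and let $\mathbf{H}_d((E))=\{(\mathbf{r}_m)_{m\ge0}\in\prod_{m\ge0}\mathbf{T}_d^{(m)}(E):\sum_m\|\mathbf{r}_m\|^2<\infty\}$. The mapping space signature $\Phi:\mathrm{Lip}_J(\square^d,E)\to\mathbf{H}_d((E))$ has level $0$ component $1$ and level $m$, $\boldsymbol\pi$-component $\Phi_m^{\boldsymbol\pi}(\mathbf{x})=\int_{D^m_{\boldsymbol\pi}}\hat d\mathbf{x}(\mathbf{t}_1)\otimes\dots\otimes\hat d\mathbf{x}(\mathbf{t}_m)\,d\mathbf{t}\in(\Lambda^dE)^{\otimes m}$. The induced linear map $\mathbf{A}=(A^{(0)},A^{(1)},\dots,A^{(m)},\dots):\mathbf{H}_d((V))\to\mathbf{H}_d((W))$ acts as the identity of $\mathbb{R}$ on level $0$ and on level $m\ge1$ as $A^{(m)}=\prod_{\boldsymbol\pi\in\Sigma_m^d}(\Lambda^dA)^{\otimes m}$, i.e. as $(\Lambda^dA)^{\otimes m}$ on each $\boldsymbol\pi$-factor, where $\Lambda^dA:\Lambda^dV\to\Lambda^dW$ is the map induced by $A$. *)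

theory Defs
  imports "HOL-Analysis.Analysis" "HOL-Analysis.Finite_Function_Topology"
    "HOL-Combinatorics.Permutations"
begin

definition finite_dimensional :: "'a::real_vector itself \<Rightarrow> bool" where
  "finite_dimensional _ \<longleftrightarrow> (\<exists>B::'a set. finite B \<and> span B = UNIV)"


section \<open>Free real vector spaces\<close>

text \<open>\<open>'k \<Rightarrow>\<^sub>0 real\<close> is the free real vector space with basis the vectors \<open>free_gen k\<close>.\<close>

abbreviation free_gen :: "'k \<Rightarrow> 'k \<Rightarrow>\<^sub>0 real" where
  "free_gen k \<equiv> Poly_Mapping.single k 1"

definition free_extend :: "('k \<Rightarrow> 'b::real_vector) \<Rightarrow> ('k \<Rightarrow>\<^sub>0 real) \<Rightarrow> 'b" where
  "free_extend f p = (\<Sum>k\<in>Poly_Mapping.keys p. Poly_Mapping.lookup p k *\<^sub>R f k)"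

lemma lookup_scaleR:
  fixes p :: "'k \<Rightarrow>\<^sub>0 real"
  shows "Poly_Mapping.lookup (c *\<^sub>R p) k = c * Poly_Mapping.lookup p k"
proof -
  have "finite {i. c * Poly_Mapping.lookup p i \<noteq> 0}"
    by (rule finite_subset[OF _ finite_lookup[of p]]) auto
  then show ?thesis
    by (simp add: scaleR_poly_mapping_def)
qed

lemma free_extend_superset:
  assumes "finite S" "Poly_Mapping.keys p \<subseteq> S"
  shows "free_extend f p = (\<Sum>k\<in>S. Poly_Mapping.lookup p k *\<^sub>R f k)"
  unfolding free_extend_def
  by (rule sum.mono_neutral_left) (use assms in \<open>auto simp: in_keys_iff\<close>)

lemma linear_free_extend: "linear (free_extend f)"
proof (rule linearI)
  fix p q :: "'a \<Rightarrow>\<^sub>0 real"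
  let ?S = "Poly_Mapping.keys p \<union> Poly_Mapping.keys q"
  have "Poly_Mapping.keys (p + q) \<subseteq> ?S"
    by (rule Poly_Mapping.keys_add)
  then show "free_extend f (p + q) = free_extend f p + free_extend f q"
    by (simp add: free_extend_superset[of ?S] lookup_add scaleR_add_left sum.distrib)
next
  fix c and p :: "'a \<Rightarrow>\<^sub>0 real"
  have "Poly_Mapping.keys (c *\<^sub>R p) \<subseteq> Poly_Mapping.keys p"
    by (auto simp: in_keys_iff lookup_scaleR)
  then show "free_extend f (c *\<^sub>R p) = c *\<^sub>R free_extend f p"
    by (simp add: free_extend_superset[of "Poly_Mapping.keys p"] lookup_scaleR scaleR_sum_right)
qed

lemma free_extend_gen [simp]: "free_extend f (free_gen k) = f k"
  by (simp add: free_extend_def)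

lemma free_extend_free_gen: "free_extend free_gen p = p"
proof (rule poly_mapping_eqI)
  fix k
  have "Poly_Mapping.lookup (free_extend free_gen p) k =
      (\<Sum>i\<in>Poly_Mapping.keys p. Poly_Mapping.lookup p i * (1 when i = k))"
    unfolding free_extend_def lookup_sum by (simp add: lookup_scaleR lookup_single)
  also have "\<dots> = (\<Sum>i\<in>Poly_Mapping.keys p. if i = k then Poly_Mapping.lookup p i else 0)"
    by (rule sum.cong) (auto simp: when_def)
  also have "\<dots> = Poly_Mapping.lookup p k"
    by (simp add: in_keys_iff)
  finally show "Poly_Mapping.lookup (free_extend free_gen p) k = Poly_Mapping.lookup p k" .
qed

lemma span_range_free_gen: "span (range free_gen) = (UNIV :: ('k \<Rightarrow>\<^sub>0 real) set)"
proof -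
  have "p \<in> span (range free_gen)" for p :: "'k \<Rightarrow>\<^sub>0 real"
    by (subst free_extend_free_gen[symmetric], unfold free_extend_def)
       (auto intro!: span_sum span_scale intro: span_base)
  then show ?thesis by blast
qed


lemma linear_eq_on_span_UNIV:
  assumes "linear f" "linear g" "span S = UNIV" "\<And>x. x \<in> S \<Longrightarrow> f x = g x"
  shows "f = g"
  using linear_eq_on_span[of f g S] assms by blast

text \<open>
  A symmetric form given on generators extends bilinearly as soon as each of its partial
  functions extends linearly.
\<close>

lemma bilinear_form_extension:
  fixes g :: "'k \<Rightarrow> 'q::real_vector" and D :: "'k \<Rightarrow> 'k \<Rightarrow> real"
  assumes sp: "span (range g) = UNIV"
    and ext: "\<And>w. \<exists>L. linear L \<and> (\<forall>v. L (g v) = D v w)"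
    and sym: "\<And>v w. D v w = D w v"
  shows "\<exists>!B. bilinear B \<and> (\<forall>v w. B (g v) (g w) = D v w)"
proof -
  obtain L where linL: "\<And>w. linear (L w)" and L: "\<And>w v. L w (g v) = D v w"
    using ext by metis
  let ?G = "free_extend g"
  have linG: "linear ?G"
    by (rule linear_free_extend)
  have "surj ?G"
  proof -
    have "span (range g) \<subseteq> range ?G"
    proof (rule span_minimal)
      show "range g \<subseteq> range ?G"
        by (metis free_extend_gen image_subsetI rangeI)
      show "subspace (range ?G)"
        by (rule linear_subspace_image[OF linG subspace_UNIV])
    qed
    then show ?thesis using sp by auto
  qed
  then obtain r where r: "\<And>y. ?G (r y) = y"
    by (metis surj_def)
  define B where "B x y = free_extend (\<lambda>w. L w x) (r y)" for x y
  have wd0: "free_extend (\<lambda>w. L w x) p = 0" if p: "?G p = 0" for p x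
  proof -
    have "linear (\<lambda>x. free_extend (\<lambda>w. L w x) p)"
      unfolding free_extend_def
      by (intro linear_compose_sum ballI linear_compose_scale_right linL)
    moreover have "free_extend (\<lambda>w. L w (g v)) p = 0" for v
    proof -
      have "free_extend (\<lambda>w. L w (g v)) p = free_extend (\<lambda>w. L v (g w)) p"
        by (simp add: L sym)
      also have "\<dots> = L v (?G p)"
        unfolding free_extend_def
        by (simp add: linear_sum[OF linL] linear_cmul[OF linL])
      finally show ?thesis
        by (simp add: p linear_0[OF linL])
    qed
    ultimately have "(\<lambda>x. free_extend (\<lambda>w. L w x) p) = (\<lambda>x. 0)"
      by (intro linear_eq_on_span_UNIV[OF _ _ sp]) (auto intro: linear_zero)
    then show ?thesis by metis
  qed
  have wd: "free_extend (\<lambda>w. L w x) p = free_extend (\<lambda>w. L w x) q" if "?G p = ?G q" for p q x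
    using wd0[of "p - q" x] that by (simp add: linear_diff[OF linear_free_extend])
  have lin1: "linear (B x)" for x
  proof (rule linearI)
    fix y z :: 'q and c :: real
    show "B x (y + z) = B x y + B x z"
      unfolding B_def linear_add[OF linear_free_extend, symmetric]
      by (rule wd) (simp add: linear_add[OF linG] r)
    show "B x (c *\<^sub>R y) = c *\<^sub>R B x y"
      unfolding B_def linear_cmul[OF linear_free_extend, symmetric]
      by (rule wd) (simp add: linear_cmul[OF linG] r)
  qed
  have lin2: "linear (\<lambda>x. B x y)" for y
    unfolding B_def free_extend_def
    by (intro linear_compose_sum ballI linear_compose_scale_right linL)
  have gen: "B (g v) (g w) = D v w" for v w
    unfolding B_def using wd[of "r (g w)" "free_gen w" "g v"] by (simp add: r L)
  have uniq: "B' = B''"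
    if B': "bilinear B'" "\<forall>v w. B' (g v) (g w) = D v w"
      and B'': "bilinear B''" "\<forall>v w. B'' (g v) (g w) = D v w" for B' B'' :: "'q \<Rightarrow> 'q \<Rightarrow> real"
  proof -
    have "B' (g v) = B'' (g v)" for v
      by (rule linear_eq_on_span_UNIV[OF _ _ sp]) (use B' B'' in \<open>auto simp: bilinear_def\<close>)
    then have "(\<lambda>x. B' x y) = (\<lambda>x. B'' x y)" for y
      by (intro linear_eq_on_span_UNIV[OF _ _ sp]) (use B' B'' in \<open>auto simp: bilinear_def\<close>)
    then show ?thesis
      by (auto simp: fun_eq_iff)
  qed
  have ex: "bilinear B \<and> (\<forall>v w. B (g v) (g w) = D v w)"
    using lin1 lin2 gen by (simp add: bilinear_def)
  show ?thesis
  proof (rule ex1I[of _ B])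
    show "B' = B" if "bilinear B' \<and> (\<forall>v w. B' (g v) (g w) = D v w)" for B'
      using that ex by (intro uniq) simp_all
  qed (rule ex)
qed


section \<open>Exterior powers\<close>

text \<open>
  For an index type \<open>'d\<close> with \<open>d\<close> elements, \<open>('d, 'a) ext_power\<close> is \<open>\<Lambda>\<^sup>d\<close> of the space \<open>'a\<close>: the free
  vector space on the families \<open>v :: 'd \<Rightarrow> 'a\<close> modulo multilinearity and vanishing on families
  with a repeated entry.
\<close>

definition ext_rels :: "(('d \<Rightarrow> 'a::real_vector) \<Rightarrow>\<^sub>0 real) set" where
  "ext_rels =
     {free_gen (v(j := a *\<^sub>R x + b *\<^sub>R y)) - a *\<^sub>R free_gen (v(j := x)) - b *\<^sub>R free_gen (v(j := y))
        | v j a b x y. True} \<union>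
     {free_gen v | v. \<exists>i j. i \<noteq> j \<and> v i = v j}"

quotient_type (overloaded) ('d, 'a) ext_power =
  "('d \<Rightarrow> 'a::real_vector) \<Rightarrow>\<^sub>0 real" / "\<lambda>p q. p - q \<in> span ext_rels"
proof (rule equivpI)
  show "reflp (\<lambda>p q. p - q \<in> span (ext_rels :: (('d \<Rightarrow> 'a) \<Rightarrow>\<^sub>0 real) set))"
    by (simp add: reflp_def span_zero)
  show "symp (\<lambda>p q. p - q \<in> span (ext_rels :: (('d \<Rightarrow> 'a) \<Rightarrow>\<^sub>0 real) set))"
    by (auto simp: symp_def intro: span_neg[of "_ - _", simplified])
  show "transp (\<lambda>p q. p - q \<in> span (ext_rels :: (('d \<Rightarrow> 'a) \<Rightarrow>\<^sub>0 real) set))"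
    by (auto simp: transp_def dest: span_add)
qed

instantiation ext_power :: (type, real_vector) real_vector
begin

lift_definition zero_ext_power :: "('a, 'b) ext_power" is 0 .

lift_definition plus_ext_power :: "('a, 'b) ext_power \<Rightarrow> ('a, 'b) ext_power \<Rightarrow> ('a, 'b) ext_power"
  is "(+)" using span_add by (fastforce simp: algebra_simps)

lift_definition minus_ext_power :: "('a, 'b) ext_power \<Rightarrow> ('a, 'b) ext_power \<Rightarrow> ('a, 'b) ext_power"
  is "(-)" using span_diff by (fastforce simp: algebra_simps)

lift_definition uminus_ext_power :: "('a, 'b) ext_power \<Rightarrow> ('a, 'b) ext_power"
  is uminus using span_neg by (fastforce simp: algebra_simps)

lift_definition scaleR_ext_power :: "real \<Rightarrow> ('a, 'b) ext_power \<Rightarrow> ('a, 'b) ext_power"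
  is "scaleR" using span_scale by (fastforce simp: scaleR_diff_right[symmetric])

instance
  by standard (transfer, simp add: algebra_simps span_zero)+

end

lift_definition wedge :: "('d \<Rightarrow> 'a::real_vector) \<Rightarrow> ('d, 'a) ext_power" is free_gen .

lemma abs_rep_ext_power: "abs_ext_power (rep_ext_power \<xi>) = \<xi>"
  by (rule Quotient3_abs_rep[OF Quotient3_ext_power])

lemma linear_abs_ext_power: "linear (abs_ext_power :: (('d \<Rightarrow> 'a::real_vector) \<Rightarrow>\<^sub>0 real) \<Rightarrow> _)"
  by (rule linearI) (simp_all add: plus_ext_power.abs_eq scaleR_ext_power.abs_eq)

lemma span_range_wedge: "span (range wedge) = (UNIV :: ('d, 'a::real_vector) ext_power set)"
proof -
  have "range wedge = abs_ext_power ` range (free_gen :: ('d \<Rightarrow> 'a) \<Rightarrow> _)"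
    by (auto simp: wedge.abs_eq image_image)
  then have "span (range wedge) = range (abs_ext_power :: (('d \<Rightarrow> 'a) \<Rightarrow>\<^sub>0 real) \<Rightarrow> _)"
    by (simp add: linear_span_image[OF linear_abs_ext_power] span_range_free_gen)
  also have "\<dots> = UNIV"
    by (rule surjI[of _ rep_ext_power]) (rule abs_rep_ext_power)
  finally show ?thesis .
qed

lemma ext_power_universal:
  fixes f :: "('d \<Rightarrow> 'a::real_vector) \<Rightarrow> 'b::real_vector"
  assumes multilinear: "\<And>v j a b x y. f (v(j := a *\<^sub>R x + b *\<^sub>R y)) = a *\<^sub>R f (v(j := x)) + b *\<^sub>R f (v(j := y))"
    and alternating: "\<And>v i j. i \<noteq> j \<Longrightarrow> v i = v j \<Longrightarrow> f v = 0"
  shows "\<exists>!L. linear L \<and> (\<forall>v. L (wedge v) = f v)"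
proof (rule ex_ex1I)
  let ?F = "free_extend f"
  have lin: "linear ?F"
    by (rule linear_free_extend)
  have 0: "?F p = 0" if "p \<in> span ext_rels" for p
  proof (rule linear_eq_0_on_span[OF lin _ that])
    fix q assume "q \<in> (ext_rels :: (('d \<Rightarrow> 'a) \<Rightarrow>\<^sub>0 real) set)"
    then consider v j a b x y where "q = free_gen (v(j := a *\<^sub>R x + b *\<^sub>R y)) -
          a *\<^sub>R free_gen (v(j := x)) - b *\<^sub>R free_gen (v(j := y))"
      | v i j where "q = free_gen v" "i \<noteq> j" "v i = v j"
      unfolding ext_rels_def by blast
    then show "?F q = 0"
    proof cases
      case 1
      then show ?thesis
        by (simp only: linear_diff[OF lin] linear_cmul[OF lin] free_extend_gen multilinear) simp
    next
      case 2
      then show ?thesis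
        using alternating by simp
    qed
  qed
  have abs: "?F (rep_ext_power (abs_ext_power p)) = ?F p" for p
  proof -
    have "abs_ext_power (rep_ext_power (abs_ext_power p)) = abs_ext_power p"
      by (rule abs_rep_ext_power)
    then have "rep_ext_power (abs_ext_power p) - p \<in> span ext_rels"
      by (simp add: ext_power.abs_eq_iff)
    from 0[OF this] show ?thesis
      by (simp add: linear_diff[OF lin])
  qed
  have "linear (\<lambda>\<xi>. ?F (rep_ext_power \<xi>))"
  proof (rule linearI)
    fix \<xi> \<eta> :: "('d, 'a) ext_power" and c
    obtain p q where pq: "\<xi> = abs_ext_power p" "\<eta> = abs_ext_power q"
      using abs_rep_ext_power[symmetric] by blast
    show "?F (rep_ext_power (\<xi> + \<eta>)) = ?F (rep_ext_power \<xi>) + ?F (rep_ext_power \<eta>)"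
      by (simp add: pq plus_ext_power.abs_eq abs linear_add[OF lin])
    show "?F (rep_ext_power (c *\<^sub>R \<xi>)) = c *\<^sub>R ?F (rep_ext_power \<xi>)"
      by (simp add: pq scaleR_ext_power.abs_eq abs linear_cmul[OF lin])
  qed
  then show "\<exists>L. linear L \<and> (\<forall>v. L (wedge v) = f v)"
    by (intro exI[of _ "\<lambda>\<xi>. ?F (rep_ext_power \<xi>)"]) (simp add: wedge.abs_eq abs)
next
  fix L L' :: "('d, 'a) ext_power \<Rightarrow> 'b"
  assume "linear L \<and> (\<forall>v. L (wedge v) = f v)" "linear L' \<and> (\<forall>v. L' (wedge v) = f v)"
  then show "L = L'"
    by (intro linear_eq_on_span_UNIV[OF _ _ span_range_wedge]) auto
qed

lemma wedge_multilinear: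
  "wedge (v(j := a *\<^sub>R x + b *\<^sub>R y)) = a *\<^sub>R wedge (v(j := x)) + b *\<^sub>R wedge (v(j := y))"
proof transfer
  fix v :: "'a \<Rightarrow> 'b" and j a b x y
  have "free_gen (v(j := a *\<^sub>R x + b *\<^sub>R y)) - a *\<^sub>R free_gen (v(j := x)) -
      b *\<^sub>R free_gen (v(j := y)) \<in> ext_rels"
    unfolding ext_rels_def by blast
  from span_base[OF this]
  show "free_gen (v(j := a *\<^sub>R x + b *\<^sub>R y)) - (a *\<^sub>R free_gen (v(j := x)) +
      b *\<^sub>R free_gen (v(j := y))) \<in> span ext_rels"
    by (simp add: diff_diff_eq)
qed

lemma wedge_alternating:
  assumes "i \<noteq> j" "v i = v j"
  shows "wedge v = 0"
  using assms
proof transfer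
  fix i j :: 'a and v :: "'a \<Rightarrow> 'b"
  assume "i \<noteq> j" "v i = v j"
  then have "free_gen v \<in> ext_rels"
    unfolding ext_rels_def by blast
  then show "free_gen v - 0 \<in> span ext_rels"
    by (simp add: span_base)
qed

definition ext_map :: "('a::real_vector \<Rightarrow> 'b::real_vector) \<Rightarrow> ('d, 'a) ext_power \<Rightarrow> ('d, 'b) ext_power" where
  "ext_map A = (THE L. linear L \<and> (\<forall>v. L (wedge v) = wedge (A \<circ> v)))"

lemma ext_map_characterization:
  assumes "linear A"
  shows "linear (ext_map A :: ('d, 'a::real_vector) ext_power \<Rightarrow> ('d, 'b::real_vector) ext_power)"
    and "ext_map A (wedge v) = wedge (A \<circ> v :: 'd \<Rightarrow> 'b)"
proof -
  have upd: "A \<circ> w(j := z) = (A \<circ> w)(j := A z)" for w :: "'d \<Rightarrow> 'a" and j z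
    by auto
  have "\<exists>!L. linear L \<and> (\<forall>v :: 'd \<Rightarrow> 'a. L (wedge v) = wedge (A \<circ> v))"
  proof (rule ext_power_universal)
    fix w :: "'d \<Rightarrow> 'a" and j a b x y
    show "wedge (A \<circ> w(j := a *\<^sub>R x + b *\<^sub>R y)) =
        a *\<^sub>R wedge (A \<circ> w(j := x)) + b *\<^sub>R wedge (A \<circ> w(j := y))"
      unfolding upd by (simp add: linear_add[OF assms] linear_cmul[OF assms] wedge_multilinear)
  next
    fix w :: "'d \<Rightarrow> 'a" and i j
    assume "i \<noteq> j" "w i = w j"
    then show "wedge (A \<circ> w) = 0"
      by (intro wedge_alternating[of i j]) auto
  qed
  from theI'[OF this]
  show "linear (ext_map A :: ('d, 'a) ext_power \<Rightarrow> ('d, 'b) ext_power)"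
    and "ext_map A (wedge v) = wedge (A \<circ> v :: 'd \<Rightarrow> 'b)"
    unfolding ext_map_def by blast+
qed

definition ext_inner :: "('d::finite, 'a::real_inner) ext_power \<Rightarrow> ('d, 'a) ext_power \<Rightarrow> real" where
  "ext_inner = (THE B. bilinear B \<and> (\<forall>v w. B (wedge v) (wedge w) = det (\<chi> i j. v i \<bullet> w j)))"

lemma ext_inner_characterization:
  fixes v w :: "'d::finite \<Rightarrow> 'a::real_inner"
  shows "bilinear (ext_inner :: ('d, 'a) ext_power \<Rightarrow> _)"
    and "ext_inner (wedge v) (wedge w) = det (\<chi> i j. v i \<bullet> w j :: real^'d^'d)"
proof -
  let ?D = "\<lambda>v w :: 'd \<Rightarrow> 'a. det (\<chi> i j. v i \<bullet> w j)"
  have "\<exists>!B. bilinear B \<and> (\<forall>v w. B (wedge v) (wedge w) = ?D v w)"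
  proof (rule bilinear_form_extension[OF span_range_wedge])
    fix w :: "'d \<Rightarrow> 'a"
    have "\<exists>!L. linear L \<and> (\<forall>v. L (wedge v) = ?D v w)"
    proof (rule ext_power_universal)
      fix v :: "'d \<Rightarrow> 'a" and k a b x y
      let ?r = "\<lambda>i z. \<chi> j. (v(k := z)) i \<bullet> w j"
      have eq: "(\<chi> i j. (v(k := z)) i \<bullet> w j) =
          (\<chi> i. if i = k then (\<chi> j. z \<bullet> w j) else (\<chi> j. v i \<bullet> w j))" for z
        by (simp add: vec_eq_iff)
      have split: "(\<chi> j. (a *\<^sub>R x + b *\<^sub>R y) \<bullet> w j) = a *s (\<chi> j. x \<bullet> w j) + b *s (\<chi> j. y \<bullet> w j)"
        by (simp add: vec_eq_iff inner_add_left)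
      show "?D (v(k := a *\<^sub>R x + b *\<^sub>R y)) w = a *\<^sub>R ?D (v(k := x)) w + b *\<^sub>R ?D (v(k := y)) w"
        unfolding eq split by (simp add: det_row_add det_row_mul)
    next
      fix v :: "'d \<Rightarrow> 'a" and i j
      assume "i \<noteq> j" "v i = v j"
      then show "?D v w = 0"
        by (intro det_identical_rows[of i j]) (auto simp: row_def)
    qed
    then show "\<exists>L. linear L \<and> (\<forall>v. L (wedge v) = ?D v w)" by blast
  next
    fix v w :: "'d \<Rightarrow> 'a"
    have "(\<chi> i j. v i \<bullet> w j) = transpose (\<chi> i j. w i \<bullet> v j)"
      by (simp add: vec_eq_iff transpose_def inner_commute)
    then show "?D v w = ?D w v"
      by (simp add: det_transpose)
  qed
  from theI'[OF this]
  show "bilinear (ext_inner :: ('d, 'a) ext_power \<Rightarrow> _)"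
    and "ext_inner (wedge v) (wedge w) = ?D v w"
    unfolding ext_inner_def by blast+
qed


section \<open>Tensor powers\<close>

text \<open>
  \<open>'u tensor\<close> is the tensor algebra of \<open>'u\<close>: the free vector space on the lists over \<open>'u\<close> modulo
  multilinearity. Its homogeneous part \<open>tensor_power m\<close> is the \<open>m\<close>-th tensor power.
\<close>

definition tensor_rels :: "('u::real_vector list \<Rightarrow>\<^sub>0 real) set" where
  "tensor_rels =
     {free_gen (xs @ (a *\<^sub>R u + b *\<^sub>R w) # ys) - a *\<^sub>R free_gen (xs @ u # ys) - b *\<^sub>R free_gen (xs @ w # ys)
        | xs a u b w ys. True}"

quotient_type (overloaded) 'u tensor =
  "'u::real_vector list \<Rightarrow>\<^sub>0 real" / "\<lambda>p q. p - q \<in> span tensor_rels"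
proof (rule equivpI)
  show "reflp (\<lambda>p q. p - q \<in> span (tensor_rels :: ('u list \<Rightarrow>\<^sub>0 real) set))"
    by (simp add: reflp_def span_zero)
  show "symp (\<lambda>p q. p - q \<in> span (tensor_rels :: ('u list \<Rightarrow>\<^sub>0 real) set))"
    by (auto simp: symp_def intro: span_neg[of "_ - _", simplified])
  show "transp (\<lambda>p q. p - q \<in> span (tensor_rels :: ('u list \<Rightarrow>\<^sub>0 real) set))"
    by (auto simp: transp_def dest: span_add)
qed

instantiation tensor :: (real_vector) real_vector
begin

lift_definition zero_tensor :: "'a tensor" is 0 .

lift_definition plus_tensor :: "'a tensor \<Rightarrow> 'a tensor \<Rightarrow> 'a tensor"
  is "(+)" using span_add by (fastforce simp: algebra_simps)

lift_definition minus_tensor :: "'a tensor \<Rightarrow> 'a tensor \<Rightarrow> 'a tensor"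
  is "(-)" using span_diff by (fastforce simp: algebra_simps)

lift_definition uminus_tensor :: "'a tensor \<Rightarrow> 'a tensor"
  is uminus using span_neg by (fastforce simp: algebra_simps)

lift_definition scaleR_tensor :: "real \<Rightarrow> 'a tensor \<Rightarrow> 'a tensor"
  is "scaleR" using span_scale by (fastforce simp: scaleR_diff_right[symmetric])

instance
  by standard (transfer, simp add: algebra_simps span_zero)+

end

lift_definition tensor_prod :: "'u::real_vector list \<Rightarrow> 'u tensor" is free_gen .

definition tensor_power :: "nat \<Rightarrow> 'u::real_vector tensor set" where
  "tensor_power m = span {tensor_prod us | us. length us = m}"

lemma abs_rep_tensor: "abs_tensor (rep_tensor \<xi>) = \<xi>"
  by (rule Quotient3_abs_rep[OF Quotient3_tensor])

lemma linear_abs_tensor: "linear (abs_tensor :: ('u::real_vector list \<Rightarrow>\<^sub>0 real) \<Rightarrow> _)"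
  by (rule linearI) (simp_all add: plus_tensor.abs_eq scaleR_tensor.abs_eq)

lemma span_range_tensor_prod: "span (range tensor_prod) = (UNIV :: 'u::real_vector tensor set)"
proof -
  have "range tensor_prod = abs_tensor ` range (free_gen :: 'u list \<Rightarrow> _)"
    by (auto simp: tensor_prod.abs_eq image_image)
  then have "span (range tensor_prod) = range (abs_tensor :: ('u list \<Rightarrow>\<^sub>0 real) \<Rightarrow> _)"
    by (simp add: linear_span_image[OF linear_abs_tensor] span_range_free_gen)
  also have "\<dots> = UNIV"
    by (rule surjI[of _ rep_tensor]) (rule abs_rep_tensor)
  finally show ?thesis .
qed

lemma tensor_universal:
  fixes f :: "'u::real_vector list \<Rightarrow> 'b::real_vector"
  assumes multilinear: "\<And>xs a u b w ys.
    f (xs @ (a *\<^sub>R u + b *\<^sub>R w) # ys) = a *\<^sub>R f (xs @ u # ys) + b *\<^sub>R f (xs @ w # ys)"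
  shows "\<exists>!L. linear L \<and> (\<forall>us. L (tensor_prod us) = f us)"
proof (rule ex_ex1I)
  let ?F = "free_extend f"
  have lin: "linear ?F"
    by (rule linear_free_extend)
  have 0: "?F p = 0" if "p \<in> span tensor_rels" for p
  proof (rule linear_eq_0_on_span[OF lin _ that])
    fix q assume "q \<in> (tensor_rels :: ('u list \<Rightarrow>\<^sub>0 real) set)"
    then obtain xs a u b w ys where "q = free_gen (xs @ (a *\<^sub>R u + b *\<^sub>R w) # ys) -
        a *\<^sub>R free_gen (xs @ u # ys) - b *\<^sub>R free_gen (xs @ w # ys)"
      unfolding tensor_rels_def by blast
    then show "?F q = 0"
      by (simp only: linear_diff[OF lin] linear_cmul[OF lin] free_extend_gen multilinear) simp
  qed
  have abs: "?F (rep_tensor (abs_tensor p)) = ?F p" for p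
  proof -
    have "abs_tensor (rep_tensor (abs_tensor p)) = abs_tensor p"
      by (rule abs_rep_tensor)
    then have "rep_tensor (abs_tensor p) - p \<in> span tensor_rels"
      by (simp add: tensor.abs_eq_iff)
    from 0[OF this] show ?thesis
      by (simp add: linear_diff[OF lin])
  qed
  have "linear (\<lambda>\<xi>. ?F (rep_tensor \<xi>))"
  proof (rule linearI)
    fix \<xi> \<eta> :: "'u tensor" and c
    obtain p q where pq: "\<xi> = abs_tensor p" "\<eta> = abs_tensor q"
      using abs_rep_tensor[symmetric] by blast
    show "?F (rep_tensor (\<xi> + \<eta>)) = ?F (rep_tensor \<xi>) + ?F (rep_tensor \<eta>)"
      by (simp add: pq plus_tensor.abs_eq abs linear_add[OF lin])
    show "?F (rep_tensor (c *\<^sub>R \<xi>)) = c *\<^sub>R ?F (rep_tensor \<xi>)"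
      by (simp add: pq scaleR_tensor.abs_eq abs linear_cmul[OF lin])
  qed
  then show "\<exists>L. linear L \<and> (\<forall>us. L (tensor_prod us) = f us)"
    by (intro exI[of _ "\<lambda>\<xi>. ?F (rep_tensor \<xi>)"]) (simp add: tensor_prod.abs_eq abs)
next
  fix L L' :: "'u tensor \<Rightarrow> 'b"
  assume "linear L \<and> (\<forall>us. L (tensor_prod us) = f us)" "linear L' \<and> (\<forall>us. L' (tensor_prod us) = f us)"
  then show "L = L'"
    by (intro linear_eq_on_span_UNIV[OF _ _ span_range_tensor_prod]) auto
qed

lemma tensor_prod_multilinear:
  "tensor_prod (xs @ (a *\<^sub>R u + b *\<^sub>R w) # ys) =
     a *\<^sub>R tensor_prod (xs @ u # ys) + b *\<^sub>R tensor_prod (xs @ w # ys)"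
proof transfer
  fix xs ys :: "'a list" and a b u w
  have "free_gen (xs @ (a *\<^sub>R u + b *\<^sub>R w) # ys) - a *\<^sub>R free_gen (xs @ u # ys) -
      b *\<^sub>R free_gen (xs @ w # ys) \<in> tensor_rels"
    unfolding tensor_rels_def by blast
  from span_base[OF this]
  show "free_gen (xs @ (a *\<^sub>R u + b *\<^sub>R w) # ys) - (a *\<^sub>R free_gen (xs @ u # ys) +
      b *\<^sub>R free_gen (xs @ w # ys)) \<in> span tensor_rels"
    by (simp add: diff_diff_eq)
qed

text \<open>On \<open>tensor_power m\<close>, \<open>tensor_map B\<close> is the \<open>m\<close>-th tensor power of \<open>B\<close>.\<close>

definition tensor_map :: "('u::real_vector \<Rightarrow> 'w::real_vector) \<Rightarrow> 'u tensor \<Rightarrow> 'w tensor" where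
  "tensor_map B = (THE L. linear L \<and> (\<forall>us. L (tensor_prod us) = tensor_prod (map B us)))"

lemma tensor_map_characterization:
  assumes "linear B"
  shows "linear (tensor_map B)" and "tensor_map B (tensor_prod us) = tensor_prod (map B us)"
proof -
  have "\<exists>!L. linear L \<and> (\<forall>us. L (tensor_prod us) = tensor_prod (map B us))"
    by (rule tensor_universal)
       (simp add: linear_add[OF assms] linear_cmul[OF assms] tensor_prod_multilinear)
  from theI'[OF this]
  show "linear (tensor_map B)" and "tensor_map B (tensor_prod us) = tensor_prod (map B us)"
    unfolding tensor_map_def by blast+
qed

text \<open>
  The inner product of tensors induced by an inner product \<open>g\<close> on \<open>'u\<close>; different tensor powers
  are orthogonal.
\<close>

definition tensor_inner :: "('u::real_vector \<Rightarrow> 'u \<Rightarrow> real) \<Rightarrow> 'u tensor \<Rightarrow> 'u tensor \<Rightarrow> real" where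
  "tensor_inner g =
     (THE B. bilinear B \<and> (\<forall>us ws. B (tensor_prod us) (tensor_prod ws) =
        (if length us = length ws then \<Prod>i<length us. g (us ! i) (ws ! i) else 0)))"

lemma tensor_inner_characterization:
  fixes g :: "'u::real_vector \<Rightarrow> 'u \<Rightarrow> real"
  assumes g: "bilinear g" and sym: "\<And>u w. g u w = g w u"
  shows "bilinear (tensor_inner g)"
    and "tensor_inner g (tensor_prod us) (tensor_prod ws) =
      (if length us = length ws then \<Prod>i<length us. g (us ! i) (ws ! i) else 0)"
proof -
  let ?D = "\<lambda>us ws. if length us = length ws then \<Prod>i<length us. g (us ! i) (ws ! i) else 0"
  have "\<exists>!B. bilinear B \<and> (\<forall>us ws. B (tensor_prod us) (tensor_prod ws) = ?D us ws)"
  proof (rule bilinear_form_extension[OF span_range_tensor_prod])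
    fix ws
    have "\<exists>!L. linear L \<and> (\<forall>us. L (tensor_prod us) = ?D us ws)"
    proof (rule tensor_universal)
      fix xs ys :: "'u list" and a b u w
      define m where "m = length xs"
      define P where "P = (\<Prod>i\<in>{..<Suc (m + length ys)} - {m}. g ((xs @ 0 # ys) ! i) (ws ! i))"
      have eq: "(\<Prod>i<Suc (m + length ys). g ((xs @ z # ys) ! i) (ws ! i)) = g z (ws ! m) * P" for z
      proof -
        have "(\<Prod>i\<in>{..<Suc (m + length ys)} - {m}. g ((xs @ z # ys) ! i) (ws ! i)) = P"
          unfolding P_def by (rule prod.cong) (auto simp: nth_append nth_Cons' m_def)
        then show ?thesis
          by (subst prod.remove[of _ m]) (auto simp: m_def)
      qed
      have len: "length (xs @ z # ys) = Suc (m + length ys)" for z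
        by (simp add: m_def)
      show "?D (xs @ (a *\<^sub>R u + b *\<^sub>R w) # ys) ws =
          a *\<^sub>R ?D (xs @ u # ys) ws + b *\<^sub>R ?D (xs @ w # ys) ws"
        unfolding len eq by (simp add: bilinear_ladd[OF g] bilinear_lmul[OF g] algebra_simps)
    qed
    then show "\<exists>L. linear L \<and> (\<forall>us. L (tensor_prod us) = ?D us ws)" by blast
  next
    fix us ws
    show "?D us ws = ?D ws us"
      by (simp add: sym)
  qed
  from theI'[OF this]
  show "bilinear (tensor_inner g)" and "tensor_inner g (tensor_prod us) (tensor_prod ws) = ?D us ws"
    unfolding tensor_inner_def by blast+
qed

text \<open>
  The integral over \<open>D\<close> of a function with values in a finite-dimensional space of tensors, tested
  against linear functionals.
\<close>

definition has_tensor_integral ::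
    "'t measure \<Rightarrow> 't set \<Rightarrow> ('t \<Rightarrow> 'u::real_vector tensor) \<Rightarrow> 'u tensor \<Rightarrow> bool" where
  "has_tensor_integral M D f I \<longleftrightarrow>
     (\<forall>l :: 'u tensor \<Rightarrow> real. linear l \<longrightarrow>
        set_integrable M D (\<lambda>t. l (f t)) \<and> (LINT t:D|M. l (f t)) = l I)"

definition tensor_integral :: "'t measure \<Rightarrow> 't set \<Rightarrow> ('t \<Rightarrow> 'u::real_vector tensor) \<Rightarrow> 'u tensor" where
  "tensor_integral M D f = (THE I. has_tensor_integral M D f I)"


section \<open>Lipschitz maps modulo Jacobian equivalence\<close>

abbreviation unit_cube :: "(real^'d) set" where
  "unit_cube \<equiv> cbox 0 1"

text \<open>
  Maps on the cube are represented by total functions. Neither the Lipschitz condition nor the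
  partial derivatives at points of the cube depend on the values outside the cube.
\<close>

definition lip_maps :: "(real^'d \<Rightarrow> 'a::real_normed_vector) set" where
  "lip_maps = {x. \<exists>L. L-lipschitz_on unit_cube x}"

definition partial_deriv :: "(real^'d \<Rightarrow> 'a::real_normed_vector) \<Rightarrow> real^'d \<Rightarrow> 'd \<Rightarrow> 'a" where
  "partial_deriv x s j =
     vector_derivative (\<lambda>u. x (\<chi> k. if k = j then u else s $ k)) (at (s $ j) within {0..1})"

definition dhat :: "(real^'d \<Rightarrow> 'a::real_normed_vector) \<Rightarrow> real^'d \<Rightarrow> ('d, 'a) ext_power" where
  "dhat x s = wedge (partial_deriv x s)"

definition jac_rel :: "(real^'d \<Rightarrow> 'a::real_normed_vector) rel" where
  "jac_rel = {(x, y). x \<in> lip_maps \<and> y \<in> lip_maps \<and>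
     (AE s in lebesgue_on unit_cube. dhat x s = dhat y s)}"

definition lip_J :: "(real^'d \<Rightarrow> 'a::real_normed_vector) set set" where
  "lip_J = lip_maps // jac_rel"

definition lip_J_map ::
    "('a::real_normed_vector \<Rightarrow> 'b::real_normed_vector) \<Rightarrow> (real^'d \<Rightarrow> 'a) set \<Rightarrow> (real^'d \<Rightarrow> 'b) set" where
  "lip_J_map A X = (\<Union>x\<in>X. jac_rel `` {A \<circ> x})"


section \<open>The mapping space signature\<close>

definition perm_families :: "nat \<Rightarrow> ('d \<Rightarrow> nat \<Rightarrow> nat) set" where
  "perm_families m = {\<pi>. \<forall>j. \<pi> j permutes {1..m}}"

definition order_simplex :: "nat \<Rightarrow> (nat \<Rightarrow> nat) \<Rightarrow> (nat \<Rightarrow> real) set" where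
  "order_simplex m p = {u. 0 \<le> u (p 1) \<and> (\<forall>i\<in>{1..<m}. u (p i) < u (p (Suc i))) \<and> u (p m) \<le> 1}"

text \<open>A point of \<open>D\<close> is the family of its rows \<open>t i :: real^'d\<close> for \<open>i \<in> {1..m}\<close>.\<close>

definition D_domain :: "nat \<Rightarrow> ('d::finite \<Rightarrow> nat \<Rightarrow> nat) \<Rightarrow> (nat \<Rightarrow> real^'d) set" where
  "D_domain m \<pi> = {t \<in> {1..m} \<rightarrow>\<^sub>E UNIV. \<forall>j. (\<lambda>i. t i $ j) \<in> order_simplex m (\<pi> j)}"

abbreviation lebesgue_rows :: "nat \<Rightarrow> (nat \<Rightarrow> real^'d::finite) measure" where
  "lebesgue_rows m \<equiv> completion (Pi\<^sub>M {1..m} (\<lambda>_. lborel))"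

definition sig_component ::
    "nat \<Rightarrow> ('d::finite \<Rightarrow> nat \<Rightarrow> nat) \<Rightarrow> (real^'d \<Rightarrow> 'a::real_normed_vector) \<Rightarrow> ('d, 'a) ext_power tensor" where
  "sig_component m \<pi> x =
     tensor_integral (lebesgue_rows m) (D_domain m \<pi>)
       (\<lambda>t. tensor_prod (map (\<lambda>i. dhat x (t i)) [1..<Suc m]))"

text \<open>
  An element \<open>(c, r)\<close> of the product of all levels has level \<open>0\<close> component \<open>c\<close> and, for \<open>m \<ge> 1\<close>,
  level \<open>m\<close> component \<open>r m\<close>. By convention \<open>r m \<pi> = 0\<close> for the irrelevant \<open>m\<close> and \<open>\<pi>\<close>.
\<close>

type_synonym ('d, 'a) levels =
  "real \<times> (nat \<Rightarrow> ('d \<Rightarrow> nat \<Rightarrow> nat) \<Rightarrow> ('d, 'a) ext_power tensor)"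

definition level_norm_sq :: "('d::finite, 'a::real_inner) levels \<Rightarrow> nat \<Rightarrow> real" where
  "level_norm_sq R m =
     (if m = 0 then (fst R)\<^sup>2
      else \<Sum>\<pi>\<in>perm_families m. tensor_inner ext_inner (snd R m \<pi>) (snd R m \<pi>))"

definition H_space :: "('d::finite, 'a::real_inner) levels set" where
  "H_space = {R.
     (\<forall>m \<pi>. if m \<ge> 1 \<and> \<pi> \<in> perm_families m then snd R m \<pi> \<in> tensor_power m else snd R m \<pi> = 0) \<and>
     summable (level_norm_sq R)}"

definition sig_map :: "(real^'d::finite \<Rightarrow> 'a::real_normed_vector) \<Rightarrow> ('d, 'a) levels" where
  "sig_map x = (1, \<lambda>m \<pi>. if m \<ge> 1 \<and> \<pi> \<in> perm_families m then sig_component m \<pi> x else 0)"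

definition signature :: "(real^'d::finite \<Rightarrow> 'a::real_normed_vector) set \<Rightarrow> ('d, 'a) levels" where
  "signature X = the_elem (sig_map ` X)"

text \<open>
  The level \<open>m\<close> part of \<open>induced_map A\<close> has norm \<open>\<parallel>\<Lambda>\<^sup>d A\<parallel>\<^sup>m\<close>, so for \<open>\<parallel>\<Lambda>\<^sup>d A\<parallel> > 1\<close> it need not preserve square
  summability. It is therefore defined on all families of levels.
\<close>

definition induced_map :: "('a::real_vector \<Rightarrow> 'b::real_vector) \<Rightarrow> ('d, 'a) levels \<Rightarrow> ('d, 'b) levels" where
  "induced_map A R = (fst R, \<lambda>m \<pi>. tensor_map (ext_map A) (snd R m \<pi>))"

end

theory Submission
  imports Defs
begin

text \<open>
  Lipschitz functions of one variable are differentiable almost everywhere, so on the cube the partial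
  derivatives of \<open>x\<close> exist almost everywhere and \<open>dhat (A \<circ> x) = ext_map A (dhat x)\<close> almost
  everywhere. In coordinates with respect to wedges of an orthonormal basis, \<open>dhat x\<close> is given by
  finitely many bounded Borel functions; hence the integrals defining the signature exist, are
  determined by linear functionals, and commute with the linear map \<open>tensor_map (ext_map A)\<close>. Square
  summability follows from \<open>|\<Phi>| \<le> C ^ m * vol D\<close> on level \<open>m\<close>: the domains \<open>D\<close> are disjoint in a cube
  of volume \<open>1\<close>, and each has volume at most \<open>1 / fact m\<close>, because the \<open>fact m\<close> orderings of a single
  column are equally likely.
\<close>


section \<open>Almost everywhere differentiability of Lipschitz functions\<close>

text \<open>\<open>partial_deriv\<close> takes an unspecified value wherever the derivative fails to
  exist, and A need not commute with that choice; this is why a differentiability theorem cannot be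
  avoided. The Jacobian involves the coordinate directions alone, so one direction at a time
  suffices and no total derivative appears. Two more obstacles shape the proof. Exterior and tensor
  powers are quotients of free vector spaces without a topology, so their integrals are defined by
  testing against all linear functionals. Commuting with a linear map then amounts to composing
  functionals, whereas existence has to be obtained from finite expansions. Moreover
  \<open>induced_map A\<close> may destroy square summability: the signature of A \<circ> x lies in
  \<open>H_space\<close> because it is itself the signature of a Lipschitz map, not because it is an
  image.\<close>

text \<open>Nonoverlapping intervals cover A inside an open set barely larger than A, and on each of
  them the mass F d - F c is at most K times the length. Besides absolute continuity, this later
  controls the mass of U - E in \<open>derivative_gap_null\<close>.\<close>

lemma emeasure_interval_measure_le:
  fixes F :: "real \<Rightarrow> real"
  assumes mono: "\<And>x y. x \<le> y \<Longrightarrow> F x \<le> F y" and cont: "continuous_on UNIV F"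
    and lip: "\<And>x y. x \<le> y \<Longrightarrow> F y - F x \<le> K * (y - x)"
    and A [measurable]: "A \<in> sets borel" and sub: "A \<subseteq> {a..b}" and "a < b"
  shows "emeasure (interval_measure F) A \<le> ennreal K * emeasure lborel A"
proof -
  let ?\<mu> = "interval_measure F"
  have "0 \<le> K"
    using mono[of 0 1] lip[of 0 1] by simp
  have Icc: "emeasure ?\<mu> {x..y} = ennreal (F y - F x)" if "x \<le> y" for x y
    by (rule emeasure_interval_measure_Icc[OF that mono cont])
  have single: "{x} \<in> null_sets ?\<mu>" for x
    using Icc[of x x] by (intro null_setsI) auto
  have "emeasure ?\<mu> A \<le> ennreal K * (emeasure lborel A + ennreal e)" if "e > 0" for e
  proof -
    obtain U where U: "open U" "A \<subseteq> U" "emeasure lborel (U - A) \<le> e"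
      using outer_regular_lborel_le[OF A \<open>e > 0\<close>] .
    have [measurable]: "U \<in> sets borel" using U by auto
    \<comment> \<open>Each covering interval is tagged by a point of A, so the value U there forces
      it into U; points outside U need some open neighbourhood and get UNIV.\<close>
    define g where "g x = (if x \<in> U then U else UNIV)" for x
    have "gauge g"
      using U by (auto simp: gauge_def g_def)
    moreover have "A \<subseteq> cbox a b" "box a b \<noteq> {}"
      using sub \<open>a < b\<close> by auto
    ultimately obtain D where D: "countable D"
        "\<And>K. K \<in> D \<Longrightarrow> interior K \<noteq> {} \<and> (\<exists>c d. K = cbox c d)"
        "pairwise (\<lambda>A B. interior A \<inter> interior B = {}) D"
        "\<And>K. K \<in> D \<Longrightarrow> \<exists>x \<in> A \<inter> K. K \<subseteq> g x" "A \<subseteq> \<Union>D"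
      using covering_lemma[of A a b g] by metis
    have "\<forall>J\<in>D. \<exists>c d. J = {c..d} \<and> c < d"
      using D(2) by fastforce
    then obtain c d where cd: "\<And>J. J \<in> D \<Longrightarrow> J = {c J..d J} \<and> c J < d J"
      by metis
    \<comment> \<open>the covering intervals overlap at their endpoints only, which carry no mass\<close>
    define N where "N = c ` D \<union> d ` D"
    have N: "N \<in> null_sets ?\<mu>"
    proof -
      have "(\<Union>x\<in>N. {x}) \<in> null_sets ?\<mu>"
        using D(1) single by (intro null_sets_UN') (auto simp: N_def)
      then show ?thesis by simp
    qed
    have disj: "disjoint_family_on interior D"
      using D(3) by (auto simp: disjoint_family_on_def pairwise_def)
    have "A \<subseteq> (\<Union>J\<in>D. interior J) \<union> N"
    proof
      fix x assume "x \<in> A"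
      then obtain J where "J \<in> D" "x \<in> J" using D(5) by blast
      have J: "J = {c J..d J}" using cd[OF \<open>J \<in> D\<close>] by blast
      have "interior J = {c J<..<d J}" using arg_cong[OF J, of interior] by simp
      moreover have "x \<in> {c J..d J}"
        using \<open>x \<in> J\<close> J by blast
      ultimately have "x \<in> interior J \<or> x = c J \<or> x = d J"
        by auto
      then show "x \<in> (\<Union>J\<in>D. interior J) \<union> N"
        using \<open>J \<in> D\<close> by (auto simp: N_def)
    qed
    then have "emeasure ?\<mu> A \<le> emeasure ?\<mu> ((\<Union>J\<in>D. interior J) \<union> N)"
      using N by (intro emeasure_mono sets.Un) (auto simp: null_sets_def intro!: borel_open)
    also have "\<dots> = emeasure ?\<mu> (\<Union>J\<in>D. interior J)"
      by (rule emeasure_Un_null_set[OF _ N]) (auto intro!: borel_open)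
    also have "\<dots> = (\<integral>\<^sup>+J. emeasure ?\<mu> (interior J) \<partial>count_space D)"
      by (rule emeasure_UN_countable[OF _ D(1) disj]) (auto intro!: borel_open)
    also have "\<dots> \<le> (\<integral>\<^sup>+J. ennreal K * emeasure lborel (interior J) \<partial>count_space D)"
    proof (rule nn_integral_mono)
      fix J assume "J \<in> space (count_space D)"
      then have J: "J = {c J..d J}" "c J < d J" using cd by auto
      have "emeasure ?\<mu> (interior J) \<le> emeasure ?\<mu> {c J..d J}"
        using equalityD1[OF J(1)] interior_subset[of J] by (intro emeasure_mono) auto
      also have "\<dots> = ennreal (F (d J) - F (c J))"
        using J(2) by (intro Icc) simp
      also have "\<dots> \<le> ennreal (K * (d J - c J))"
        using J(2) by (intro ennreal_leI lip) simp
      also have "\<dots> = ennreal K * emeasure lborel {c J<..<d J}"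
        using J(2) \<open>0 \<le> K\<close> by (simp add: ennreal_mult)
      also have "{c J<..<d J} = interior J"
        using arg_cong[OF J(1), of interior] by simp
      finally show "emeasure ?\<mu> (interior J) \<le> ennreal K * emeasure lborel (interior J)" .
    qed
    also have "\<dots> = ennreal K * (\<integral>\<^sup>+J. emeasure lborel (interior J) \<partial>count_space D)"
      by (rule nn_integral_cmult) simp
    also have "(\<integral>\<^sup>+J. emeasure lborel (interior J) \<partial>count_space D) = emeasure lborel (\<Union>J\<in>D. interior J)"
      by (rule emeasure_UN_countable[OF _ D(1) disj, symmetric]) (auto intro!: borel_open)
    also have "\<dots> \<le> emeasure lborel (A \<union> (U - A))"
    proof (rule emeasure_mono)
      show "(\<Union>J\<in>D. interior J) \<subseteq> A \<union> (U - A)"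
        using D(4) U(2) interior_subset by (fastforce simp: g_def)
    qed auto
    also have "\<dots> \<le> emeasure lborel A + ennreal e"
      using emeasure_subadditive[of A lborel "U - A"] U(3) by (auto intro: order_trans add_left_mono)
    finally show ?thesis by (simp add: mult_left_mono)
  qed
  then have *: "emeasure ?\<mu> A \<le> ennreal K * emeasure lborel A + ennreal (K * e)" if "e > 0" for e
    using that \<open>0 \<le> K\<close> by (simp add: distrib_left ennreal_mult)
  show ?thesis
  proof (rule ennreal_le_epsilon)
    fix e :: real assume "e > 0"
    \<comment> \<open>Dividing by K + 1 instead of K covers the case K = 0.\<close>
    have "emeasure ?\<mu> A \<le> ennreal K * emeasure lborel A + ennreal (K * (e / (K + 1)))"
      by (rule *) (use \<open>e > 0\<close> \<open>0 \<le> K\<close> in simp)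
    also have "\<dots> \<le> ennreal K * emeasure lborel A + ennreal e"
      using \<open>e > 0\<close> \<open>0 \<le> K\<close> by (intro add_left_mono ennreal_leI) (simp add: field_simps)
    finally show "emeasure ?\<mu> A \<le> ennreal K * emeasure lborel A + ennreal e" .
  qed
qed

text \<open>Vitali's theorem selects disjoint small intervals inside U that cover E up to a Lebesgue
  null set, which \<open>ac\<close> makes null for M; the inequality is summed over them. Two
  abstract measures appear because the comparison is used in both directions, with Lebesgue measure
  on either side.\<close>

lemma Vitali_measure_compare:
  fixes M N :: "real measure"
  assumes sM [measurable_cong]: "sets M = sets borel" and sN [measurable_cong]: "sets N = sets borel"
    and ac: "null_sets lborel \<subseteq> null_sets M"
    and E [measurable]: "E \<in> sets borel" and U: "open U" "E \<subseteq> U"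
    and fine: "\<And>x \<delta>. x \<in> E \<Longrightarrow> \<delta> > 0 \<Longrightarrow> \<exists>a b. a < b \<and> x \<in> {a..b} \<and> b - a < \<delta> \<and>
      p * emeasure M {a..b} \<le> q * emeasure N {a..b}"
  shows "p * emeasure M E \<le> q * emeasure N U"
proof -
  \<comment> \<open>Intervals are coded as (centre, radius), as the covering theorem for closed
    balls expects.\<close>
  define K where "K = {(c, r). 0 < r \<and> cball c r \<subseteq> U \<and>
    p * emeasure M (cball c r) \<le> q * emeasure N (cball c r)}"
  have "\<exists>i. i \<in> K \<and> x \<in> cball (fst i) (snd i) \<and> snd i < d" if x: "x \<in> E" and "0 < d" for x d
  proof -
    obtain e where e: "e > 0" "ball x e \<subseteq> U"
      using U x open_contains_ball by blast
    obtain a b where ab: "a < b" "x \<in> {a..b}" "b - a < min d e"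
        "p * emeasure M {a..b} \<le> q * emeasure N {a..b}"
      using fine[OF x, of "min d e"] e \<open>0 < d\<close> by auto
    have eq: "cball ((a + b) / 2) ((b - a) / 2) = {a..b}"
      by (simp add: cball_eq_atLeastAtMost field_simps)
    have "{a..b} \<subseteq> U"
      using ab e by (auto simp: dist_real_def subset_iff)
    then show ?thesis
      using ab eq by (intro exI[of _ "((a + b) / 2, (b - a) / 2)"]) (auto simp: K_def)
  qed
  moreover have "\<And>i. i \<in> K \<Longrightarrow> 0 < snd i"
    by (auto simp: K_def)
  ultimately obtain C where C: "countable C" "C \<subseteq> K"
      "pairwise (\<lambda>i j. disjnt (cball (fst i) (snd i)) (cball (fst j) (snd j))) C"
      "negligible (E - (\<Union>i\<in>C. cball (fst i) (snd i)))"
    using Vitali_covering_theorem_cballs[of K snd E fst] by (metis (no_types, lifting))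
  define I where "I i = cball (fst i) (snd i)" for i :: "real \<times> real"
  have I [measurable]: "I i \<in> sets borel" for i
    by (simp add: I_def)
  have UI [measurable]: "(\<Union>i\<in>C. I i) \<in> sets borel"
    by (rule sets.countable_UN''[OF C(1)]) (rule I)
  have disj: "disjoint_family_on I C"
    using C(3) by (auto simp: disjoint_family_on_def pairwise_def disjnt_def I_def)
  have "E - (\<Union>i\<in>C. I i) \<in> null_sets lborel"
    using C(4) by (auto simp: negligible_iff_null_sets I_def[symmetric] null_sets_completion_iff)
  then have nul: "E - (\<Union>i\<in>C. I i) \<in> null_sets M"
    using ac by blast
  have "emeasure M E \<le> emeasure M ((\<Union>i\<in>C. I i) \<union> (E - (\<Union>i\<in>C. I i)))"
    by (intro emeasure_mono) (auto simp: sM)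
  also have "\<dots> = emeasure M (\<Union>i\<in>C. I i)"
    by (rule emeasure_Un_null_set[OF _ nul]) (simp add: sM)
  also have "\<dots> = (\<integral>\<^sup>+i. emeasure M (I i) \<partial>count_space C)"
    by (rule emeasure_UN_countable[OF _ C(1) disj]) (simp add: sM)
  finally have "p * emeasure M E \<le> (\<integral>\<^sup>+i. p * emeasure M (I i) \<partial>count_space C)"
    by (simp add: nn_integral_cmult mult_left_mono)
  also have "\<dots> \<le> (\<integral>\<^sup>+i. q * emeasure N (I i) \<partial>count_space C)"
    using C(2) by (intro nn_integral_mono) (auto simp: K_def I_def)
  also have "\<dots> = q * (\<integral>\<^sup>+i. emeasure N (I i) \<partial>count_space C)"
    by (rule nn_integral_cmult) simp
  also have "(\<integral>\<^sup>+i. emeasure N (I i) \<partial>count_space C) = emeasure N (\<Union>i\<in>C. I i)"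
    by (rule emeasure_UN_countable[OF _ C(1) disj, symmetric]) (simp add: sN)
  also have "\<dots> \<le> emeasure N U"
    using C(2) U(1) by (intro emeasure_mono) (fastforce simp: K_def I_def sN)+
  finally show ?thesis by (simp add: mult_left_mono)
qed

text \<open>
  The points where the lower derivative of \<open>f\<close> in the direction \<open>e\<close> is essentially below \<open>p\<close> and the
  upper one above \<open>q\<close>. Away from these sets, for rational \<open>p < q\<close>, a Lipschitz \<open>f\<close> is differentiable
  in the direction \<open>e\<close>.
\<close>

definition derivative_gap ::
    "('a::real_normed_vector \<Rightarrow> real) \<Rightarrow> 'a \<Rightarrow> real \<Rightarrow> real \<Rightarrow> 'a set" where
  "derivative_gap f e p q =
     {s. (\<forall>\<delta>>0. \<exists>h. h \<noteq> 0 \<and> \<bar>h\<bar> < \<delta> \<and> (f (s + h *\<^sub>R e) - f s) / h < p) \<and>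
         (\<forall>\<delta>>0. \<exists>h. h \<noteq> 0 \<and> \<bar>h\<bar> < \<delta> \<and> (f (s + h *\<^sub>R e) - f s) / h > q)}"

text \<open>Each quotient is continuous in s, so for fixed \<delta> the union over all h, though
  uncountable, is open. Restricting \<delta> to the values 1 / Suc n exhibits the set as a countable
  intersection of open sets.\<close>

lemma borel_derivative_gap:
  fixes f :: "'a::real_normed_vector \<Rightarrow> real"
  assumes "continuous_on UNIV f"
  shows "derivative_gap f e p q \<in> sets borel"
proof -
  define Q where "Q h s = (f (s + h *\<^sub>R e) - f s) / h" for h s
  have Q: "continuous_on UNIV (Q h)" for h
    unfolding Q_def divide_inverse
    by (intro continuous_intros continuous_on_compose2[OF assms]) auto
  have eq: "derivative_gap f e p q =
      (\<Inter>n::nat. \<Union>h\<in>{h. h \<noteq> 0 \<and> \<bar>h\<bar> < 1 / Suc n}. {s. Q h s < p}) \<inter>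
      (\<Inter>n::nat. \<Union>h\<in>{h. h \<noteq> 0 \<and> \<bar>h\<bar> < 1 / Suc n}. {s. Q h s > q})" (is "_ = ?R")
  proof (intro equalityI subsetI)
    fix s assume s: "s \<in> derivative_gap f e p q"
    have "1 / real (Suc n) > 0" for n by simp
    with s show "s \<in> ?R"
      unfolding derivative_gap_def Q_def by blast
  next
    fix s assume s: "s \<in> ?R"
    show "s \<in> derivative_gap f e p q"
      unfolding derivative_gap_def
    proof (intro CollectI conjI allI impI)
      fix \<delta> :: real assume "\<delta> > 0"
      then obtain n where n: "1 / Suc n < \<delta>"
        using nat_approx_posE by blast
      have "s \<in> (\<Union>h\<in>{h. h \<noteq> 0 \<and> \<bar>h\<bar> < 1 / Suc n}. {s. Q h s < p})"
        using s by blast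
      then obtain h where "h \<noteq> 0" "\<bar>h\<bar> < 1 / Suc n" "Q h s < p"
        by blast
      with n show "\<exists>h. h \<noteq> 0 \<and> \<bar>h\<bar> < \<delta> \<and> (f (s + h *\<^sub>R e) - f s) / h < p"
        unfolding Q_def by (meson less_trans)
      have "s \<in> (\<Union>h\<in>{h. h \<noteq> 0 \<and> \<bar>h\<bar> < 1 / Suc n}. {s. Q h s > q})"
        using s by blast
      then obtain h where "h \<noteq> 0" "\<bar>h\<bar> < 1 / Suc n" "Q h s > q"
        by blast
      with n show "\<exists>h. h \<noteq> 0 \<and> \<bar>h\<bar> < \<delta> \<and> (f (s + h *\<^sub>R e) - f s) / h > q"
        unfolding Q_def by (meson less_trans)
    qed
  qed
  show ?thesis
    unfolding eq
    by (intro sets.Int sets.countable_INT'' borel_open open_UN ballI open_Collect_less Q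
        continuous_on_const) auto
qed

text \<open>
  The monotone function \<open>F x = f x + L * x\<close> defines a measure \<open>\<mu>\<close>. On a bounded part \<open>E\<close> of the gap set,
  Vitali coverings by intervals of large and of small slope give \<open>q' * |E| \<le> \<mu> E \<le> p' * |E|\<close> up to
  \<open>\<epsilon>\<close>, with \<open>p' < q'\<close>.
\<close>

lemma derivative_gap_null:
  fixes f :: "real \<Rightarrow> real"
  assumes lip: "L-lipschitz_on UNIV f" and "p < q"
  shows "derivative_gap f 1 p q \<in> null_sets lborel"
proof -
  have "0 \<le> L" and L: "\<bar>f y - f x\<bar> \<le> L * \<bar>y - x\<bar>" for x y
    using lip by (auto simp: lipschitz_on_def dist_real_def abs_minus_commute)
  define F where "F x = f x + L * x" for x
  have contf: "continuous_on UNIV f"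
    by (rule lipschitz_on_continuous_on[OF lip])
  have cont: "continuous_on UNIV F"
    unfolding F_def by (intro continuous_intros contf)
  have mono: "F x \<le> F y" if "x \<le> y" for x y
    using L[of y x] that by (auto simp: F_def algebra_simps abs_if split: if_splits)
  have lipF: "F y - F x \<le> (2 * L) * (y - x)" if "x \<le> y" for x y
    using L[of y x] that by (auto simp: F_def algebra_simps abs_if split: if_splits)
  let ?\<mu> = "interval_measure F"
  have Icc: "emeasure ?\<mu> {x..y} = ennreal (F y - F x)" if "x \<le> y" for x y
    by (rule emeasure_interval_measure_Icc[OF that mono cont])
  have bound: "emeasure ?\<mu> A \<le> ennreal (2 * L) * emeasure lborel A"
    if "A \<in> sets borel" "A \<subseteq> {-real n..real n}" for A n
    by (rule emeasure_interval_measure_le[OF mono cont lipF that(1), of "-real (Suc n)" "real (Suc n)"])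
       (use that(2) in auto)
  have ac: "null_sets lborel \<subseteq> null_sets ?\<mu>"
  proof
    fix N :: "real set" assume N: "N \<in> null_sets lborel"
    have "N \<inter> {-real n..real n} \<in> null_sets ?\<mu>" for n
    proof -
      have "emeasure lborel (N \<inter> {-real n..real n}) = 0"
        using N by (metis emeasure_mono inf_le1 le_zero_eq null_setsD1 null_setsD2)
      then show ?thesis
        using bound[of "N \<inter> {-real n..real n}" n] N by (intro null_setsI) auto
    qed
    then have "(\<Union>n. N \<inter> {-real n..real n}) \<in> null_sets ?\<mu>"
      by (intro null_sets_UN') auto
    moreover have "(\<Union>n. N \<inter> {-real n..real n}) = N"
    proof -
      have "\<exists>n. x \<in> {-real n..real n}" for x
        using real_arch_simple[of "\<bar>x\<bar>"] by (auto simp: abs_le_iff minus_le_iff)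
      then show ?thesis by blast
    qed
    ultimately show "N \<in> null_sets ?\<mu>" by simp
  qed
  define G where "G = derivative_gap f 1 p q"
  have Gb: "G \<in> sets borel"
    unfolding G_def by (rule borel_derivative_gap[OF contf])
  define p' q' where "p' = p + L" and "q' = q + L"
  \<comment> \<open>Whatever the sign of h, x is an endpoint of an interval of length \<bar>h\<bar>
    on which the slope of F is the quotient of f shifted by L.\<close>
  have slope: "\<exists>a b. a < b \<and> x \<in> {a..b} \<and> b - a < \<delta> \<and>
      (F b - F a) / (b - a) = (f (x + h) - f x) / h + L" if "h \<noteq> 0" "\<bar>h\<bar> < \<delta>" for x h \<delta>
  proof (cases "h > 0")
    case True
    then show ?thesis
      using that by (intro exI[of _ x] exI[of _ "x + h"]) (auto simp: F_def field_simps)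
  next
    case False
    then show ?thesis
      using that by (intro exI[of _ "x + h"] exI[of _ x]) (auto simp: F_def field_simps)
  qed
  have null: "G \<inter> {-real n<..<real n} \<in> null_sets lborel" for n
  proof -
    define E where "E = G \<inter> {-real n<..<real n}"
    have E [measurable]: "E \<in> sets borel" using Gb by (simp add: E_def)
    have Efin: "emeasure lborel E \<le> emeasure lborel {-real n<..<real n}"
      by (intro emeasure_mono) (auto simp: E_def)
    then have Efin: "emeasure lborel E < \<infinity>"
      by (rule le_less_trans) simp
    \<comment> \<open>\<open>ennreal\<close> truncates negative numbers, so the signs of q' and p'
      matter. A point of E has a quotient below p, and all quotients are at least -L.\<close>
    have q': "0 \<le> q'" if "E \<noteq> {}"
    proof -
      obtain x where "x \<in> G" using \<open>E \<noteq> {}\<close> by (auto simp: E_def)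
      then have "\<exists>h. h \<noteq> 0 \<and> \<bar>h\<bar> < 1 \<and> (f (x + h *\<^sub>R 1) - f x) / h < p"
        unfolding G_def derivative_gap_def using zero_less_one by blast
      then obtain h where h: "h \<noteq> 0" "(f (x + h) - f x) / h < p"
        by auto
      have "\<bar>(f (x + h) - f x) / h\<bar> \<le> L"
        using L[of "x + h" x] h(1) by (simp add: field_simps)
      with h \<open>p < q\<close> show ?thesis unfolding q'_def by linarith
    qed
    have p': "0 \<le> p'" if "E \<noteq> {}"
    proof -
      obtain x where "x \<in> G" using \<open>E \<noteq> {}\<close> by (auto simp: E_def)
      then have "\<exists>h. h \<noteq> 0 \<and> \<bar>h\<bar> < 1 \<and> (f (x + h *\<^sub>R 1) - f x) / h < p"
        unfolding G_def derivative_gap_def using zero_less_one by blast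
      then obtain h where h: "h \<noteq> 0" "(f (x + h) - f x) / h < p"
        by auto
      have "\<bar>(f (x + h) - f x) / h\<bar> \<le> L"
        using L[of "x + h" x] h(1) by (simp add: field_simps)
      with h show ?thesis unfolding p'_def by linarith
    qed
    have "emeasure lborel E = 0"
    proof (cases "E = {}")
      case False
      define m where "m = measure lborel E"
      have m: "emeasure lborel E = ennreal m" "0 \<le> m"
        using Efin by (auto simp: m_def emeasure_eq_ennreal_measure)
      \<comment> \<open>With \<bar>U - E\<bar> at most \<epsilon>: q' * \<bar>E\<bar> is at most
        \<mu> U, which splits into \<mu> E, at most p' * \<bar>U\<bar>, and \<mu> (U - E), at most 2
        * L * \<epsilon>.\<close>
      have "q' * m \<le> p' * m + (p' + 2 * L) * \<epsilon>" if "\<epsilon> > 0" for \<epsilon>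
      proof -
        obtain U0 where U0: "open U0" "E \<subseteq> U0" "emeasure lborel (U0 - E) \<le> \<epsilon>"
          using outer_regular_lborel_le[OF E \<open>\<epsilon> > 0\<close>] .
        define U where "U = U0 \<inter> {-real n<..<real n}"
        have U: "open U" "E \<subseteq> U" "U \<subseteq> {-real n..real n}"
          using U0 by (auto simp: U_def E_def)
        have Ub [measurable]: "U \<in> sets borel" using U by auto
        have "emeasure lborel (U - E) \<le> emeasure lborel (U0 - E)"
          using U0 by (intro emeasure_mono) (auto simp: U_def)
        with U0 have UE: "emeasure lborel (U - E) \<le> \<epsilon>" by (meson order_trans)
        have upper: "ennreal q' * emeasure lborel E \<le> 1 * emeasure ?\<mu> U"
        proof (rule Vitali_measure_compare[OF _ _ _ E U(1,2)])
          fix x \<delta> :: real assume "x \<in> E" "\<delta> > 0"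
          then obtain h where h: "h \<noteq> 0" "\<bar>h\<bar> < \<delta>" "(f (x + h) - f x) / h > q"
            unfolding E_def G_def derivative_gap_def by force
          obtain a b where ab: "a < b" "x \<in> {a..b}" "b - a < \<delta>" "(F b - F a) / (b - a) = (f (x + h) - f x) / h + L"
            using slope[OF h(1,2)] by metis
          have "q' \<le> (F b - F a) / (b - a)"
            using ab h by (simp add: q'_def)
          with ab have "q' * (b - a) \<le> F b - F a"
            by (simp add: field_simps)
          then have "ennreal q' * emeasure lborel {a..b} \<le> 1 * emeasure ?\<mu> {a..b}"
            using ab q'[OF False] by (simp add: Icc ennreal_mult[symmetric] ennreal_leI)
          with ab show "\<exists>a b. a < b \<and> x \<in> {a..b} \<and> b - a < \<delta> \<and>
              ennreal q' * emeasure lborel {a..b} \<le> 1 * emeasure ?\<mu> {a..b}" by blast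
        qed auto
        have lower: "1 * emeasure ?\<mu> E \<le> ennreal p' * emeasure lborel U"
        proof (rule Vitali_measure_compare[OF _ _ ac E U(1,2)])
          fix x \<delta> :: real assume "x \<in> E" "\<delta> > 0"
          then obtain h where h: "h \<noteq> 0" "\<bar>h\<bar> < \<delta>" "(f (x + h) - f x) / h < p"
            unfolding E_def G_def derivative_gap_def by force
          obtain a b where ab: "a < b" "x \<in> {a..b}" "b - a < \<delta>" "(F b - F a) / (b - a) = (f (x + h) - f x) / h + L"
            using slope[OF h(1,2)] by metis
          have "(F b - F a) / (b - a) \<le> p'"
            using ab h by (simp add: p'_def)
          with ab have "F b - F a \<le> p' * (b - a)"
            by (simp add: field_simps)
          then have "1 * emeasure ?\<mu> {a..b} \<le> ennreal p' * emeasure lborel {a..b}"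
            using ab p'[OF False] by (simp add: Icc ennreal_mult[symmetric] ennreal_leI)
          with ab show "\<exists>a b. a < b \<and> x \<in> {a..b} \<and> b - a < \<delta> \<and>
              1 * emeasure ?\<mu> {a..b} \<le> ennreal p' * emeasure lborel {a..b}" by blast
        qed auto
        have "U = E \<union> (U - E)" using U by blast
        then have split: "emeasure M U \<le> emeasure M E + emeasure M (U - E)" if "sets M = sets borel" for M
          using emeasure_subadditive[of E M "U - E"] that by simp
        have "ennreal q' * ennreal m \<le> emeasure ?\<mu> E + emeasure ?\<mu> (U - E)"
          using upper split[of ?\<mu>] by (simp add: m)
        also have "emeasure ?\<mu> (U - E) \<le> ennreal (2 * L) * emeasure lborel (U - E)"
          using U(3) by (intro bound[of _ n]) auto
        also have "\<dots> \<le> ennreal (2 * L) * ennreal \<epsilon>"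
          using UE by (intro mult_left_mono) auto
        also have "emeasure ?\<mu> E \<le> ennreal p' * emeasure lborel U"
          using lower by simp
        also have "emeasure lborel U \<le> ennreal m + ennreal \<epsilon>"
          using split[of lborel] UE by (auto simp: m intro: order_trans add_left_mono)
        finally have "ennreal q' * ennreal m \<le> ennreal p' * (ennreal m + ennreal \<epsilon>) + ennreal (2 * L) * ennreal \<epsilon>"
          by (simp add: add_right_mono mult_left_mono)
        also have "\<dots> = ennreal (p' * (m + \<epsilon>) + 2 * L * \<epsilon>)"
          using p'[OF False] \<open>0 \<le> m\<close> \<open>0 \<le> L\<close> \<open>\<epsilon> > 0\<close>
          by (simp add: ennreal_mult[symmetric] ennreal_plus[symmetric] del: ennreal_plus)
        also have "ennreal q' * ennreal m = ennreal (q' * m)"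
          using q'[OF False] \<open>0 \<le> m\<close> by (simp add: ennreal_mult)
        finally have "q' * m \<le> p' * (m + \<epsilon>) + 2 * L * \<epsilon>"
          using p'[OF False] \<open>0 \<le> m\<close> \<open>0 \<le> L\<close> \<open>\<epsilon> > 0\<close>
          by (subst (asm) ennreal_le_iff) auto
        then show ?thesis by (simp add: algebra_simps)
      qed
      then have *: "q' * m \<le> p' * m + (p' + 2 * L) * \<epsilon>" if "\<epsilon> > 0" for \<epsilon>
        using that by blast
      have "q' * m \<le> p' * m"
      proof (rule field_le_epsilon)
        fix e :: real assume "e > 0"
        \<comment> \<open>The summand 1 keeps c positive even if p' = L = 0.\<close>
        define c where "c = p' + 2 * L + 1"
        have c: "c > 0" using p'[OF False] \<open>0 \<le> L\<close> by (simp add: c_def)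
        have "(p' + 2 * L) * (e / c) \<le> c * (e / c)"
          using c \<open>e > 0\<close> by (intro mult_right_mono) (auto simp: c_def)
        also have "\<dots> = e" using c by simp
        finally show "q' * m \<le> p' * m + e"
          using *[of "e / c"] c \<open>e > 0\<close> by simp
      qed
      then have "m = 0"
        using \<open>p < q\<close> \<open>0 \<le> m\<close> by (simp add: p'_def q'_def mult_le_cancel_right)
      then show ?thesis by (simp add: m)
    qed simp
    then show ?thesis
      using E by (auto simp: E_def[symmetric])
  qed
  have "(\<Union>n. G \<inter> {-real n<..<real n}) \<in> null_sets lborel"
    using null by (intro null_sets_UN') auto
  moreover have "(\<Union>n. G \<inter> {-real n<..<real n}) = G"
  proof -
    have "\<exists>n. x \<in> {-real n<..<real n}" for x
      using reals_Archimedean2[of "\<bar>x\<bar>"] by (auto simp: abs_less_iff minus_less_iff)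
    then show ?thesis by blast
  qed
  ultimately show ?thesis by (simp add: G_def)
qed

text \<open>If the lower limit were below the upper one, two rationals strictly between them would
  contradict \<open>gap\<close>; \<open>bound\<close> excludes an infinite limit.\<close>

lemma tendsto_of_no_gap:
  fixes f :: "real \<Rightarrow> real"
  assumes F: "F \<noteq> bot" and bound: "\<forall>\<^sub>F h in F. \<bar>f h\<bar> \<le> L"
    and gap: "\<And>p q. p < q \<Longrightarrow> p \<in> \<rat> \<Longrightarrow> q \<in> \<rat> \<Longrightarrow> (\<forall>\<^sub>F h in F. p \<le> f h) \<or> (\<forall>\<^sub>F h in F. f h \<le> q)"
  shows "\<exists>D. (f \<longlongrightarrow> D) F"
proof -
  let ?g = "\<lambda>h. ereal (f h)"
  have "\<not> Liminf F ?g < Limsup F ?g"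
  proof
    assume "Liminf F ?g < Limsup F ?g"
    \<comment> \<open>Lower and upper limit are extended reals, so reals p'' < p' < q' are inserted
      first and the rationals p and q are chosen between these.\<close>
    then obtain q' where q': "Liminf F ?g < ereal q'" "ereal q' < Limsup F ?g"
      using ereal_dense2 by blast
    obtain p' where p': "Liminf F ?g < ereal p'" "ereal p' < ereal q'"
      using ereal_dense2[OF q'(1)] by blast
    then obtain q where q: "q \<in> \<rat>" "p' < q" "q < q'"
      using Rats_dense_in_real[of p' q'] by auto
    obtain p'' where p'': "Liminf F ?g < ereal p''" "ereal p'' < ereal p'"
      using ereal_dense2[OF p'(1)] by blast
    then obtain p where p: "p \<in> \<rat>" "p'' < p" "p < p'"
      using Rats_dense_in_real[of p'' p'] by auto
    from gap[of p q] p q consider "\<forall>\<^sub>F h in F. p \<le> f h" | "\<forall>\<^sub>F h in F. f h \<le> q"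
      by fastforce
    then show False
    proof cases
      case 1
      then have "ereal p \<le> Liminf F ?g"
        by (intro Liminf_bounded) simp
      with p'' p show False
        by (metis ereal_less(2) less_ereal.simps(1) less_trans not_less)
    next
      case 2
      then have "Limsup F ?g \<le> ereal q"
        by (intro Limsup_bounded) simp
      with q' q show False
        by (metis less_ereal.simps(1) less_trans not_less)
    qed
  qed
  then have eq: "Liminf F ?g = Limsup F ?g"
    using Liminf_le_Limsup[OF F, of ?g] by simp
  then have lim: "(?g \<longlongrightarrow> Limsup F ?g) F"
    using F by (simp add: tendsto_iff_Liminf_eq_Limsup)
  have "Limsup F ?g \<le> ereal L"
    using bound by (intro Limsup_bounded) (auto elim: eventually_mono)
  moreover have "ereal (-L) \<le> Liminf F ?g"
    using bound by (intro Liminf_bounded) (auto elim: eventually_mono)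
  ultimately have "\<bar>Limsup F ?g\<bar> \<noteq> \<infinity>"
    unfolding eq by auto
  then obtain D where "Limsup F ?g = ereal D"
    by auto
  with lim show ?thesis by auto
qed

text \<open>
  By translation invariance the measure of \<open>N\<close> is the mean over \<open>t \<in> {0..1}\<close> of the measures of its
  translates by \<open>t *\<^sub>R e\<close>, so that Fubini applies without splitting off a coordinate.
\<close>

lemma null_set_of_null_lines:
  fixes N :: "'a::euclidean_space set"
  assumes N [measurable]: "N \<in> sets borel"
    and lines: "\<And>s. {t. s + t *\<^sub>R e \<in> N} \<in> null_sets lborel"
  shows "N \<in> null_sets lborel"
proof -
  have shift: "(\<integral>\<^sup>+ s. indicator N (s + t *\<^sub>R e) \<partial>lborel) = emeasure lborel N" for t
  proof -
    have "(\<integral>\<^sup>+ s. indicator N (s + t *\<^sub>R e) \<partial>lborel) =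
        (\<integral>\<^sup>+ s. indicator N s \<partial>distr lborel borel ((+) (t *\<^sub>R e)))"
      by (subst nn_integral_distr) (auto simp: add.commute)
    also have "\<dots> = emeasure lborel N"
      by (simp add: lborel_distr_plus)
    finally show ?thesis .
  qed
  have "(\<integral>\<^sup>+ t. (\<integral>\<^sup>+ s. indicator {0..1::real} t * indicator N (s + t *\<^sub>R e) \<partial>lborel) \<partial>lborel) =
      (\<integral>\<^sup>+ s. (\<integral>\<^sup>+ t. indicator {0..1::real} t * indicator N (s + t *\<^sub>R e) \<partial>lborel) \<partial>lborel)"
    by (rule lborel_pair.Fubini'[symmetric]) measurable
  also have "\<dots> = (\<integral>\<^sup>+ s. 0 \<partial>(lborel :: 'a measure))"
  proof (rule nn_integral_cong)
    fix s :: 'a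
    have "(\<integral>\<^sup>+ t. indicator {0..1::real} t * indicator N (s + t *\<^sub>R e) \<partial>lborel) \<le>
        (\<integral>\<^sup>+ t. indicator {t. s + t *\<^sub>R e \<in> N} t \<partial>lborel)"
      by (rule nn_integral_mono) (auto split: split_indicator)
    also have "\<dots> = emeasure lborel {t. s + t *\<^sub>R e \<in> N}"
      using lines[of s] by (intro nn_integral_indicator) (auto simp: null_sets_def)
    also have "\<dots> = 0" using lines[of s] by auto
    finally show "(\<integral>\<^sup>+ t. indicator {0..1::real} t * indicator N (s + t *\<^sub>R e) \<partial>lborel) = 0" by simp
  qed
  finally have "(\<integral>\<^sup>+ t. (\<integral>\<^sup>+ s. indicator {0..1::real} t * indicator N (s + t *\<^sub>R e) \<partial>lborel) \<partial>lborel) = 0"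
    by simp
  moreover have "(\<integral>\<^sup>+ t. (\<integral>\<^sup>+ s. indicator {0..1::real} t * indicator N (s + t *\<^sub>R e) \<partial>lborel) \<partial>lborel) =
      (\<integral>\<^sup>+ t. emeasure lborel N * indicator {0..1::real} t \<partial>lborel)"
    by (rule nn_integral_cong) (simp add: nn_integral_cmult shift mult.commute)
  moreover have "\<dots> = emeasure lborel N"
    by (simp add: nn_integral_cmult)
  ultimately show ?thesis
    by (intro null_setsI) auto
qed

lemma lipschitz_quotient_bound:
  fixes f :: "'a::real_normed_vector \<Rightarrow> real"
  assumes lip: "L-lipschitz_on UNIV f" and "norm e = 1"
  shows "\<bar>(f (s + h *\<^sub>R e) - f s) / h\<bar> \<le> L"
proof (cases "h = 0")
  case True
  then show ?thesis using lip by (simp add: lipschitz_on_def)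
next
  case False
  have "\<bar>f (s + h *\<^sub>R e) - f s\<bar> \<le> L * \<bar>h\<bar>"
    using lipschitz_onD[OF lip, of "s + h *\<^sub>R e" s] \<open>norm e = 1\<close> by (simp add: dist_norm)
  with False show ?thesis by (simp add: field_simps)
qed

text \<open>On a line in direction e, the gap set of f is the gap set of the restriction of f, a
  Lipschitz function of one variable, hence null. Rational p < q leave only countably many
  exceptional sets.\<close>

lemma lipschitz_directional_derivative_AE:
  fixes f :: "'a::euclidean_space \<Rightarrow> real"
  assumes lip: "L-lipschitz_on UNIV f" and e: "norm e = 1"
  shows "AE s in lborel. \<exists>D. ((\<lambda>h. (f (s + h *\<^sub>R e) - f s) / h) \<longlongrightarrow> D) (at 0)"
proof -
  define N where "N = (\<Union>p\<in>\<rat>. \<Union>q\<in>\<rat> \<inter> {p<..}. derivative_gap f e p q)"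
  have contf: "continuous_on UNIV f"
    by (rule lipschitz_on_continuous_on[OF lip])
  have null: "derivative_gap f e p q \<in> null_sets lborel" if "p < q" for p q
  proof (rule null_set_of_null_lines[where e=e])
    show "derivative_gap f e p q \<in> sets borel"
      by (rule borel_derivative_gap[OF contf])
    fix s
    have "L-lipschitz_on UNIV (\<lambda>t. f (s + t *\<^sub>R e))"
    proof (rule lipschitz_onI)
      fix t u :: real
      have "s + t *\<^sub>R e - (s + u *\<^sub>R e) = (t - u) *\<^sub>R e" by (simp add: algebra_simps)
      then have "dist (s + t *\<^sub>R e) (s + u *\<^sub>R e) = dist t u"
        using e by (simp only: dist_norm norm_scaleR) simp
      then show "dist (f (s + t *\<^sub>R e)) (f (s + u *\<^sub>R e)) \<le> L * dist t u"
        using lipschitz_onD[OF lip, of "s + t *\<^sub>R e" "s + u *\<^sub>R e"] by simp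
    qed (rule lipschitz_on_nonneg[OF lip])
    from derivative_gap_null[OF this \<open>p < q\<close>]
    show "{t. s + t *\<^sub>R e \<in> derivative_gap f e p q} \<in> null_sets lborel"
      by (simp add: derivative_gap_def scaleR_add_left add.assoc)
  qed
  have "N \<in> null_sets lborel"
    unfolding N_def
    by (intro null_sets_UN' null) (auto simp: countable_rat intro: countable_subset[OF _ countable_rat])
  moreover have "\<exists>D. ((\<lambda>h. (f (s + h *\<^sub>R e) - f s) / h) \<longlongrightarrow> D) (at 0)" if s: "s \<notin> N" for s
  proof (rule tendsto_of_no_gap[where L=L])
    show "\<forall>\<^sub>F h in at 0. \<bar>(f (s + h *\<^sub>R e) - f s) / h\<bar> \<le> L"
      using lipschitz_quotient_bound[OF lip e] by (intro always_eventually) blast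
    fix p q :: real assume pq: "p < q" "p \<in> \<rat>" "q \<in> \<rat>"
    then have "s \<notin> derivative_gap f e p q"
      using s by (auto simp: N_def)
    then have "(\<exists>\<delta>>0. \<forall>h. h \<noteq> 0 \<and> \<bar>h\<bar> < \<delta> \<longrightarrow> \<not> (f (s + h *\<^sub>R e) - f s) / h < p) \<or>
        (\<exists>\<delta>>0. \<forall>h. h \<noteq> 0 \<and> \<bar>h\<bar> < \<delta> \<longrightarrow> \<not> (f (s + h *\<^sub>R e) - f s) / h > q)"
      unfolding derivative_gap_def by blast
    then show "(\<forall>\<^sub>F h in at 0. p \<le> (f (s + h *\<^sub>R e) - f s) / h) \<or>
        (\<forall>\<^sub>F h in at 0. (f (s + h *\<^sub>R e) - f s) / h \<le> q)"
      by (simp add: eventually_at dist_real_def not_less)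
  qed auto
  ultimately show ?thesis
    by (intro AE_I'[of N]) auto
qed

text \<open>
  The derivative is only determined almost everywhere; where the limit fails to exist, \<open>lim\<close> is
  arbitrary and has to be truncated to keep the bound.
\<close>

lemma lipschitz_directional_derivative:
  fixes f :: "'a::euclidean_space \<Rightarrow> real"
  assumes lip: "L-lipschitz_on UNIV f" and e: "norm e = 1"
  obtains D where "D \<in> borel_measurable borel" "\<And>s. \<bar>D s\<bar> \<le> L"
    "AE s in lborel. ((\<lambda>h. (f (s + h *\<^sub>R e) - f s) / h) \<longlongrightarrow> D s) (at 0)"
proof -
  have contf: "continuous_on UNIV f"
    by (rule lipschitz_on_continuous_on[OF lip])
  \<comment> \<open>A single sequence of steps makes the candidate a limit of countably many
    continuous functions, hence Borel; it agrees with the full limit wherever that exists.\<close>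
  define Q where "Q n s = (f (s + (1 / Suc n) *\<^sub>R e) - f s) / (1 / Suc n)" for n s
  have Q: "Q n \<in> borel_measurable borel" for n
    unfolding Q_def divide_inverse
    by (intro borel_measurable_continuous_onI continuous_intros continuous_on_compose2[OF contf]) auto
  define D0 where "D0 s = lim (\<lambda>n. Q n s)" for s
  have D0 [measurable]: "D0 \<in> borel_measurable borel"
    unfolding D0_def by (rule borel_measurable_lim_metric[OF Q])
  define D where "D s = (if \<bar>D0 s\<bar> \<le> L then D0 s else 0)" for s
  show thesis
  proof
    show "D \<in> borel_measurable borel"
      unfolding D_def by measurable
    show "\<bar>D s\<bar> \<le> L" for s
      using lipschitz_on_nonneg[OF lip] by (simp add: D_def)
    have "((\<lambda>h. (f (s + h *\<^sub>R e) - f s) / h) \<longlongrightarrow> D s) (at 0)"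
      if *: "((\<lambda>h. (f (s + h *\<^sub>R e) - f s) / h) \<longlongrightarrow> d) (at 0)" for s d
    proof -
      have "filterlim (\<lambda>n. 1 / real (Suc n)) (at 0) sequentially"
        by (rule filterlim_atI[OF LIMSEQ_Suc[OF lim_1_over_n]]) auto
      from filterlim_compose[OF * this] have "(\<lambda>n. Q n s) \<longlonglongrightarrow> d"
        by (simp add: Q_def)
      moreover have "\<bar>Q n s\<bar> \<le> L" for n
        unfolding Q_def by (rule lipschitz_quotient_bound[OF lip e])
      ultimately have "D0 s = d" "\<bar>d\<bar> \<le> L"
        unfolding D0_def by (auto intro: limI LIMSEQ_le_const2[OF tendsto_rabs])
      with * show ?thesis by (simp add: D_def)
    qed
    then show "AE s in lborel. ((\<lambda>h. (f (s + h *\<^sub>R e) - f s) / h) \<longlongrightarrow> D s) (at 0)"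
      by (intro eventually_mono[OF lipschitz_directional_derivative_AE[OF lip e]]) blast
  qed
qed

section \<open>Orthonormal bases of finite-dimensional inner product spaces\<close>

text \<open>The spaces have class \<open>real_inner\<close> and carry no distinguished basis, so a
  basis is a chosen finite set.\<close>

definition orthonormal_basis :: "'a::real_inner set \<Rightarrow> bool" where
  "orthonormal_basis B \<longleftrightarrow>
     finite B \<and> (\<forall>b\<in>B. \<forall>c\<in>B. b \<bullet> c = (if b = c then 1 else 0)) \<and> span B = UNIV"

text \<open>Gram-Schmidt along a finite spanning set; a vector whose residue r after projection
  vanishes contributes nothing to the span and is skipped.\<close>

lemma orthonormal_basis_exists:
  assumes "finite_dimensional TYPE('a::real_inner)"
  obtains B :: "'a::real_inner set" where "orthonormal_basis B"
proof -
  obtain S :: "'a set" where S: "finite S" "span S = UNIV"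
    using assms by (auto simp: finite_dimensional_def)
  have "\<exists>B. finite B \<and> (\<forall>b\<in>B. \<forall>c\<in>B. b \<bullet> c = (if b = c then 1 else 0)) \<and> span B = span T"
    if "finite T" for T :: "'a set"
    using that
  proof (induction T rule: finite_induct)
    case empty
    then show ?case by (intro exI[of _ "{}"]) auto
  next
    case (insert a T)
    then obtain B where B: "finite B" "\<forall>b\<in>B. \<forall>c\<in>B. b \<bullet> c = (if b = c then 1 else 0)" "span B = span T"
      by blast
    define p where "p = (\<Sum>b\<in>B. (a \<bullet> b) *\<^sub>R b)"
    define r where "r = a - p"
    have p: "p \<in> span B"
      unfolding p_def by (intro span_sum span_scale span_base)
    have orth: "r \<bullet> c = 0" if c: "c \<in> B" for c
    proof -
      have "p \<bullet> c = (\<Sum>b\<in>B. (a \<bullet> b) * (if b = c then 1 else 0))"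
        unfolding p_def inner_sum_left using B(2) c by (intro sum.cong) auto
      also have "\<dots> = a \<bullet> c" using B(1) c by (simp add: if_distrib cong: if_cong)
      finally show ?thesis by (simp add: r_def inner_diff_left)
    qed
    have span_a: "span (insert a T) = span (insert r B)"
    proof -
      have "span (insert a T) = span (insert a B)"
        using B(3) by (metis span_insert)
      also have "\<dots> = span (insert r B)"
        by (rule eq_span_insert_eq) (simp add: r_def p)
      finally show ?thesis .
    qed
    show ?case
    proof (cases "r = 0")
      case True
      then show ?thesis using B span_a by (intro exI[of _ B]) (simp add: span_insert_0)
    next
      case False
      define u where "u = r /\<^sub>R norm r"
      have "span (insert u B) = span (insert r B)"
      proof (rule span_eq[THEN iffD2], intro conjI insert_subsetI)
        show "u \<in> span (insert r B)"
          unfolding u_def by (intro span_scale span_base) simp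
        have "r = norm r *\<^sub>R u" using False by (simp add: u_def)
        then show "r \<in> span (insert u B)"
          by (metis insertI1 span_base span_scale)
      qed (auto intro: span_base)
      moreover have "u \<bullet> u = 1"
        using False by (simp add: u_def dot_square_norm power2_eq_square)
      moreover have "u \<bullet> c = 0" "c \<bullet> u = 0" if "c \<in> B" for c
        using orth[OF that] by (auto simp: u_def inner_commute)
      moreover have "u \<notin> B"
        using calculation by auto
      ultimately show ?thesis
        using B span_a by (intro exI[of _ "insert u B"]) auto
    qed
  qed
  from this[OF S(1)] show thesis
    using that S(2) unfolding orthonormal_basis_def by auto
qed

lemma orthonormal_basis_expansion:
  assumes "orthonormal_basis B"
  shows "(\<Sum>b\<in>B. (x \<bullet> b) *\<^sub>R b) = x"
proof -
  have "(\<lambda>x. \<Sum>b\<in>B. (x \<bullet> b) *\<^sub>R b) = (\<lambda>x. x)"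
  proof (rule linear_eq_on_span_UNIV[of _ _ B])
    show "linear (\<lambda>x. \<Sum>b\<in>B. (x \<bullet> b) *\<^sub>R b)"
      by (rule linearI) (simp_all add: inner_add_left scaleR_add_left sum.distrib scaleR_sum_right)
    fix x assume "x \<in> B"
    then have "(\<Sum>b\<in>B. (x \<bullet> b) *\<^sub>R b) = (\<Sum>b\<in>B. if b = x then b else 0)"
      using assms by (intro sum.cong) (auto simp: orthonormal_basis_def)
    also have "\<dots> = x" using assms \<open>x \<in> B\<close> by (simp add: orthonormal_basis_def)
    finally show "(\<Sum>b\<in>B. (x \<bullet> b) *\<^sub>R b) = x" .
  qed (use assms in \<open>auto simp: orthonormal_basis_def linear_id[unfolded id_def]\<close>)
  then show ?thesis by metis
qed

text \<open>In coordinates A is a finite sum of bounded maps. Boundedness is what lets A pass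
  through derivatives and preserve the Lipschitz condition.\<close>

lemma bounded_linear_finite_dimensional:
  fixes A :: "'a::real_inner \<Rightarrow> 'b::real_normed_vector"
  assumes "finite_dimensional TYPE('a)" "linear A"
  shows "bounded_linear A"
proof -
  obtain B :: "'a set" where B: "orthonormal_basis B"
    using orthonormal_basis_exists[OF assms(1)] .
  have A: "A x = (\<Sum>b\<in>B. (x \<bullet> b) *\<^sub>R A b)" for x
    by (subst orthonormal_basis_expansion[OF B, of x, symmetric])
       (simp add: linear_sum[OF assms(2)] linear_cmul[OF assms(2)])
  have "A = (\<lambda>x. \<Sum>b\<in>B. (x \<bullet> b) *\<^sub>R A b)"
    by (rule ext) (rule A)
  then show ?thesis
    by (rule ssubst) (intro bounded_linear_sum bounded_linear_scaleR_const bounded_linear_inner_left)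
qed


section \<open>The Jacobian of a Lipschitz map\<close>

text \<open>Composition with \<open>clamp\<close> extends x from the cube to the whole space, where
  the differentiability theorem applies; on slices within the cube the extension changes
  nothing.\<close>

lemma clamped_slice:
  fixes x :: "real^'d::finite \<Rightarrow> 'a"
  assumes s: "s \<in> unit_cube" and u: "u \<in> {0..1}"
  shows "x (\<chi> k. if k = j then u else s $ k) = x (clamp 0 1 (s + (u - s $ j) *\<^sub>R axis j 1))"
proof -
  have "s + (u - s $ j) *\<^sub>R axis j 1 = (\<chi> k. if k = j then u else s $ k)"
    by (simp add: vec_eq_iff axis_def)
  moreover have "(\<chi> k. if k = j then u else s $ k) \<in> unit_cube"
    using s u by (auto simp: mem_box_cart)
  ultimately show ?thesis by simp
qed

text \<open>Clamping does not increase distances and basis vectors have norm 1, so each coordinate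
  of the extended map is L-Lipschitz on the whole space. Its two-sided derivative restricts to the
  derivative within \<open>{0..1}\<close>, which at faces of the cube is one-sided.\<close>

lemma partial_deriv_representation:
  fixes x :: "real^'d::finite \<Rightarrow> 'v::real_inner"
  assumes B: "orthonormal_basis B" and lip: "L-lipschitz_on unit_cube x"
  obtains D where "\<And>b j. b \<in> B \<Longrightarrow> D b j \<in> borel_measurable borel"
    "\<And>b j s. b \<in> B \<Longrightarrow> \<bar>D b j s\<bar> \<le> L"
    "AE s in lborel. s \<in> unit_cube \<longrightarrow> (\<forall>j.
       ((\<lambda>u. x (\<chi> k. if k = j then u else s $ k)) has_vector_derivative (\<Sum>b\<in>B. D b j s *\<^sub>R b))
         (at (s $ j) within {0..1}))"
proof -
  define y where "y b s = x (clamp 0 1 s) \<bullet> b" for b s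
  have "0 \<le> L" by (rule lipschitz_on_nonneg[OF lip])
  have y: "L-lipschitz_on UNIV (y b)" if "b \<in> B" for b
  proof (rule lipschitz_onI[OF _ \<open>0 \<le> L\<close>])
    fix s t :: "real^'d"
    have "norm b = 1"
      using B \<open>b \<in> B\<close> by (auto simp: orthonormal_basis_def norm_eq_sqrt_inner)
    have cube: "clamp 0 1 r \<in> unit_cube" for r :: "real^'d"
      by (rule clamp_in_interval) (auto simp: Basis_vec_def inner_axis)
    have "dist (y b s) (y b t) = \<bar>(x (clamp 0 1 s) - x (clamp 0 1 t)) \<bullet> b\<bar>"
      by (simp add: y_def dist_real_def inner_diff_left)
    also have "\<dots> \<le> dist (x (clamp 0 1 s)) (x (clamp 0 1 t))"
      using Cauchy_Schwarz_ineq2[of "x (clamp 0 1 s) - x (clamp 0 1 t)" b] \<open>norm b = 1\<close>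
      by (simp add: dist_norm)
    also have "\<dots> \<le> L * dist (clamp 0 1 s) (clamp 0 1 t)"
      by (rule lipschitz_onD[OF lip cube cube])
    also have "\<dots> \<le> L * dist s t"
      by (intro mult_left_mono dist_clamps_le_dist_args \<open>0 \<le> L\<close>)
    finally show "dist (y b s) (y b t) \<le> L * dist s t" .
  qed
  define P where "P b j E \<longleftrightarrow> E \<in> borel_measurable borel \<and> (\<forall>s. \<bar>E s\<bar> \<le> L) \<and>
      (AE s in lborel. ((\<lambda>h. (y b (s + h *\<^sub>R axis j 1) - y b s) / h) \<longlongrightarrow> E s) (at 0))"
    for b and j :: 'd and E
  define D where "D b j = (SOME E. P b j E)" for b j
  have "\<exists>E. P b j E" if "b \<in> B" for b j
    unfolding P_def
    by (rule lipschitz_directional_derivative[OF y[OF that], of "axis j 1"]) auto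
  then have "P b j (D b j)" if "b \<in> B" for b j
    unfolding D_def using that by (metis someI_ex)
  then have D: "\<And>b j. b \<in> B \<Longrightarrow> D b j \<in> borel_measurable borel"
      "\<And>b j s. b \<in> B \<Longrightarrow> \<bar>D b j s\<bar> \<le> L"
      "\<And>b j. b \<in> B \<Longrightarrow> AE s in lborel. ((\<lambda>h. (y b (s + h *\<^sub>R axis j 1) - y b s) / h) \<longlongrightarrow> D b j s) (at 0)"
    unfolding P_def by blast+
  have "finite B" using B by (simp add: orthonormal_basis_def)
  show thesis
  proof (rule that[OF D(1,2)])
    have "AE s in lborel. \<forall>b\<in>B. \<forall>j\<in>UNIV. ((\<lambda>h. (y b (s + h *\<^sub>R axis j 1) - y b s) / h) \<longlongrightarrow> D b j s) (at 0)"
      using D(3) \<open>finite B\<close> by (intro AE_finite_allI) auto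
    then show "AE s in lborel. s \<in> unit_cube \<longrightarrow> (\<forall>j.
       ((\<lambda>u. x (\<chi> k. if k = j then u else s $ k)) has_vector_derivative (\<Sum>b\<in>B. D b j s *\<^sub>R b))
         (at (s $ j) within {0..1}))"
    proof (rule eventually_mono, intro impI allI)
      fix s :: "real^'d" and j
      assume lim: "\<forall>b\<in>B. \<forall>j\<in>UNIV. ((\<lambda>h. (y b (s + h *\<^sub>R axis j 1) - y b s) / h) \<longlongrightarrow> D b j s) (at 0)"
        and s: "s \<in> unit_cube"
      have "((\<lambda>u. y b (s + (u - s $ j) *\<^sub>R axis j 1)) has_real_derivative D b j s) (at (s $ j))"
        if "b \<in> B" for b
        using lim that by (simp add: DERIV_def)
      then have "((\<lambda>u. \<Sum>b\<in>B. y b (s + (u - s $ j) *\<^sub>R axis j 1) *\<^sub>R b) has_vector_derivative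
          (\<Sum>b\<in>B. D b j s *\<^sub>R b)) (at (s $ j) within {0..1})"
        by (intro has_vector_derivative_sum has_vector_derivative_scaleR[where g="\<lambda>_. b" and g'=0 for b, simplified])
           (auto intro: has_field_derivative_at_within)
      then show "((\<lambda>u. x (\<chi> k. if k = j then u else s $ k)) has_vector_derivative (\<Sum>b\<in>B. D b j s *\<^sub>R b))
         (at (s $ j) within {0..1})"
      proof (rule has_vector_derivative_transform[rotated 2])
        show "s $ j \<in> {0..1}" using s by (simp add: mem_box_cart)
        fix u :: real assume "u \<in> {0..1}"
        then show "x (\<chi> k. if k = j then u else s $ k) = (\<Sum>b\<in>B. y b (s + (u - s $ j) *\<^sub>R axis j 1) *\<^sub>R b)"
          by (simp add: clamped_slice[OF s] y_def orthonormal_basis_expansion[OF B])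
      qed
    qed
  qed
qed

text \<open>The interval \<open>{0..1}\<close> is nondegenerate, so derivatives within it are unique
  even at its endpoints.\<close>

lemma partial_deriv_eqI:
  assumes "((\<lambda>u. x (\<chi> k. if k = j then u else s $ k)) has_vector_derivative D) (at (s $ j) within {0..1})"
    and "s \<in> unit_cube"
  shows "partial_deriv x s j = D"
  unfolding partial_deriv_def
  by (rule vector_derivative_within_cbox[of 0 1, unfolded box_real])
     (use assms in \<open>auto simp: mem_box_cart\<close>)

lemma wedge_update_sum:
  assumes "finite S"
  shows "wedge (v(j := \<Sum>b\<in>S. c b *\<^sub>R b)) = (\<Sum>b\<in>S. c b *\<^sub>R wedge (v(j := b)))"
proof -
  have lin: "linear (\<lambda>z. wedge (v(j := z)))"
    using wedge_multilinear[of v j 1 _ 1] wedge_multilinear[of v j _ _ 0]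
    by (intro linearI) simp_all
  show ?thesis
    by (simp add: linear_sum[OF lin] linear_cmul[OF lin])
qed

text \<open>The slots are multiplied out one at a time: J holds those already expanded and w fills
  the others, which stays arbitrary because the step replaces w by w(i := v i). Families with
  repeated or permuted entries are kept, since a finite generating family is wanted rather than a
  basis.\<close>

lemma wedge_expansion:
  fixes v :: "'d::finite \<Rightarrow> 'a::real_vector"
  assumes "finite S" and v: "\<And>j. v j = (\<Sum>b\<in>S. c j b *\<^sub>R b)"
  shows "wedge v = (\<Sum>\<phi>\<in>UNIV \<rightarrow>\<^sub>E S. (\<Prod>j\<in>UNIV. c j (\<phi> j)) *\<^sub>R wedge \<phi>)"
proof -
  have "wedge (\<lambda>j. if j \<in> J then v j else w j) =
      (\<Sum>\<phi>\<in>J \<rightarrow>\<^sub>E S. (\<Prod>j\<in>J. c j (\<phi> j)) *\<^sub>R wedge (\<lambda>j. if j \<in> J then \<phi> j else w j))"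
    if "finite J" for J and w :: "'d \<Rightarrow> 'a"
    using that
  proof (induction J arbitrary: w rule: finite_induct)
    case empty
    then show ?case by simp
  next
    case (insert i J)
    have upd: "(\<lambda>j. if j \<in> J then \<phi> j else (w(i := z)) j) = (\<lambda>j. if j \<in> J then \<phi> j else w j)(i := z)"
      for \<phi> z using insert.hyps(2) by auto
    have upd': "(\<lambda>j. if j \<in> insert i J then (\<phi>(i := z)) j else w j) = (\<lambda>j. if j \<in> J then \<phi> j else w j)(i := z)"
      for \<phi> z using insert.hyps(2) by auto
    have prd: "(\<Prod>j\<in>insert i J. c j ((\<phi>(i := z)) j)) = c i z * (\<Prod>j\<in>J. c j (\<phi> j))" for \<phi> z
    proof -
      have "(\<Prod>j\<in>J. c j ((\<phi>(i := z)) j)) = (\<Prod>j\<in>J. c j (\<phi> j))"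
        using insert.hyps(2) by (intro prod.cong) auto
      then show ?thesis using insert.hyps by simp
    qed
    \<comment> \<open>Extending a choice on J by a value at i yields every choice on
      \<open>insert i J\<close> exactly once, which merges the two sums.\<close>
    have inj: "inj_on (\<lambda>(y, g). g(i := y)) (S \<times> (J \<rightarrow>\<^sub>E S))"
      using inj_combinator[of i J "\<lambda>_. S"] insert.hyps(2) by simp
    have "wedge (\<lambda>j. if j \<in> insert i J then v j else w j) =
        wedge (\<lambda>j. if j \<in> J then v j else (w(i := v i)) j)"
      by (rule arg_cong[where f=wedge]) auto
    also have "\<dots> = (\<Sum>\<phi>\<in>J \<rightarrow>\<^sub>E S. (\<Prod>j\<in>J. c j (\<phi> j)) *\<^sub>R
        wedge ((\<lambda>j. if j \<in> J then \<phi> j else w j)(i := v i)))"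
      by (subst insert.IH) (simp only: upd)
    also have "\<dots> = (\<Sum>\<phi>\<in>J \<rightarrow>\<^sub>E S. \<Sum>b\<in>S. (c i b * (\<Prod>j\<in>J. c j (\<phi> j))) *\<^sub>R
        wedge ((\<lambda>j. if j \<in> J then \<phi> j else w j)(i := b)))"
      unfolding v wedge_update_sum[OF \<open>finite S\<close>] by (simp add: scaleR_sum_right mult.commute)
    also have "\<dots> = (\<Sum>(b, \<phi>)\<in>S \<times> (J \<rightarrow>\<^sub>E S). (\<Prod>j\<in>insert i J. c j ((\<phi>(i := b)) j)) *\<^sub>R
        wedge (\<lambda>j. if j \<in> insert i J then (\<phi>(i := b)) j else w j))"
      unfolding prd upd' by (subst sum.swap) (simp add: sum.cartesian_product)
    also have "\<dots> = (\<Sum>\<phi>\<in>insert i J \<rightarrow>\<^sub>E S. (\<Prod>j\<in>insert i J. c j (\<phi> j)) *\<^sub>R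
        wedge (\<lambda>j. if j \<in> insert i J then \<phi> j else w j))"
      unfolding PiE_insert_eq by (subst sum.reindex[OF inj]) (simp add: case_prod_unfold)
    finally show ?case .
  qed
  from this[of UNIV] show ?thesis by simp
qed

lemma AE_lebesgue_on_cube:
  "(AE s in lebesgue_on unit_cube. P s) \<longleftrightarrow> (AE s in lborel. s \<in> (unit_cube :: (real^'d) set) \<longrightarrow> P s)"
proof -
  have "unit_cube \<inter> space lebesgue \<in> sets (lebesgue :: (real^'d) measure)"
    by simp
  from AE_restrict_space_iff[OF this] show ?thesis
    by (simp only: AE_completion_iff)
qed

text \<open>The coefficients are Borel and bounded everywhere, whereas \<open>dhat x\<close> itself
  is controlled only almost everywhere; all measurability below is drawn from them.\<close>

lemma dhat_representation:
  fixes x :: "real^'d::finite \<Rightarrow> 'v::real_inner"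
  assumes "finite_dimensional TYPE('v)" and "x \<in> lip_maps"
  obtains I :: "('d \<Rightarrow> 'v) set" and c C where "finite I" "0 \<le> C"
    "\<And>\<phi>. \<phi> \<in> I \<Longrightarrow> c \<phi> \<in> borel_measurable borel" "\<And>\<phi> s. \<phi> \<in> I \<Longrightarrow> \<bar>c \<phi> s\<bar> \<le> C"
    "AE s in lborel. s \<in> unit_cube \<longrightarrow> dhat x s = (\<Sum>\<phi>\<in>I. c \<phi> s *\<^sub>R wedge \<phi>)"
proof -
  obtain B :: "'v set" where B: "orthonormal_basis B"
    using orthonormal_basis_exists[OF assms(1)] .
  then have "finite B" by (simp add: orthonormal_basis_def)
  obtain L where lip: "L-lipschitz_on unit_cube x"
    using assms(2) by (auto simp: lip_maps_def)
  have "0 \<le> L" by (rule lipschitz_on_nonneg[OF lip])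
  obtain D where D: "\<And>b j. b \<in> B \<Longrightarrow> D b j \<in> borel_measurable borel"
    "\<And>b j s. b \<in> B \<Longrightarrow> \<bar>D b j s\<bar> \<le> L"
    "AE s in lborel. s \<in> unit_cube \<longrightarrow> (\<forall>j.
       ((\<lambda>u. x (\<chi> k. if k = j then u else s $ k)) has_vector_derivative (\<Sum>b\<in>B. D b j s *\<^sub>R b))
         (at (s $ j) within {0..1}))"
    using partial_deriv_representation[OF B lip] by blast
  \<comment> \<open>Each coefficient is a product of d coordinate derivatives, each bounded by
    L.\<close>
  show thesis
  proof (rule that[of "UNIV \<rightarrow>\<^sub>E B" "L ^ CARD('d)" "\<lambda>\<phi> s. \<Prod>j\<in>UNIV. D (\<phi> j) j s"])
    show "finite (UNIV \<rightarrow>\<^sub>E B :: ('d \<Rightarrow> 'v) set)"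
      using \<open>finite B\<close> by (intro finite_PiE) auto
    show "0 \<le> L ^ CARD('d)" using \<open>0 \<le> L\<close> by simp
    fix \<phi> :: "'d \<Rightarrow> 'v" assume "\<phi> \<in> UNIV \<rightarrow>\<^sub>E B"
    then have \<phi>: "\<phi> j \<in> B" for j by auto
    show "(\<lambda>s. \<Prod>j\<in>UNIV. D (\<phi> j) j s) \<in> borel_measurable borel"
      by (intro borel_measurable_prod D(1) \<phi>)
    show "\<bar>\<Prod>j\<in>UNIV. D (\<phi> j) j s\<bar> \<le> L ^ CARD('d)" for s
    proof -
      have "\<bar>\<Prod>j\<in>UNIV. D (\<phi> j) j s\<bar> \<le> (\<Prod>j\<in>(UNIV::'d set). L)"
        unfolding abs_prod by (intro prod_mono conjI abs_ge_zero D(2) \<phi>)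
      then show ?thesis by simp
    qed
  next
    show "AE s in lborel. s \<in> unit_cube \<longrightarrow>
        dhat x s = (\<Sum>\<phi>\<in>UNIV \<rightarrow>\<^sub>E B. (\<Prod>j\<in>UNIV. D (\<phi> j) j s) *\<^sub>R wedge \<phi>)"
      using D(3)
    proof (rule eventually_mono, intro impI)
      fix s :: "real^'d"
      assume D: "s \<in> unit_cube \<longrightarrow> (\<forall>j.
         ((\<lambda>u. x (\<chi> k. if k = j then u else s $ k)) has_vector_derivative (\<Sum>b\<in>B. D b j s *\<^sub>R b))
           (at (s $ j) within {0..1}))" and s: "s \<in> unit_cube"
      show "dhat x s = (\<Sum>\<phi>\<in>UNIV \<rightarrow>\<^sub>E B. (\<Prod>j\<in>UNIV. D (\<phi> j) j s) *\<^sub>R wedge \<phi>)"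
        unfolding dhat_def
        by (rule wedge_expansion[OF \<open>finite B\<close>]) (use D s in \<open>blast intro: partial_deriv_eqI\<close>)
    qed
  qed
qed

text \<open>At a point where all partial derivatives exist, the bounded linear A passes through each
  of them; the remaining points form a null set.\<close>

lemma dhat_linear_image:
  fixes A :: "'v::real_inner \<Rightarrow> 'w::real_inner" and x :: "real^'d::finite \<Rightarrow> 'v"
  assumes "finite_dimensional TYPE('v)" "linear A" "x \<in> lip_maps"
  shows "AE s in lebesgue_on unit_cube. dhat (A \<circ> x) s = ext_map A (dhat x s)"
proof -
  have A: "bounded_linear A"
    by (rule bounded_linear_finite_dimensional[OF assms(1,2)])
  obtain B :: "'v set" where B: "orthonormal_basis B"
    using orthonormal_basis_exists[OF assms(1)] .
  obtain L where lip: "L-lipschitz_on unit_cube x"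
    using assms(3) by (auto simp: lip_maps_def)
  obtain D where D: "\<And>b j. b \<in> B \<Longrightarrow> D b j \<in> borel_measurable borel"
    "\<And>b j s. b \<in> B \<Longrightarrow> \<bar>D b j s\<bar> \<le> L"
    "AE s in lborel. s \<in> unit_cube \<longrightarrow> (\<forall>j.
       ((\<lambda>u. x (\<chi> k. if k = j then u else s $ k)) has_vector_derivative (\<Sum>b\<in>B. D b j s *\<^sub>R b))
         (at (s $ j) within {0..1}))"
    using partial_deriv_representation[OF B lip] by blast
  show ?thesis
    unfolding AE_lebesgue_on_cube using D(3)
  proof (rule eventually_mono, intro impI)
    fix s :: "real^'d"
    assume D: "s \<in> unit_cube \<longrightarrow> (\<forall>j.
       ((\<lambda>u. x (\<chi> k. if k = j then u else s $ k)) has_vector_derivative (\<Sum>b\<in>B. D b j s *\<^sub>R b))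
         (at (s $ j) within {0..1}))" and s: "s \<in> unit_cube"
    have "partial_deriv (A \<circ> x) s j = A (partial_deriv x s j)" for j
    proof -
      have *: "((\<lambda>u. x (\<chi> k. if k = j then u else s $ k)) has_vector_derivative (\<Sum>b\<in>B. D b j s *\<^sub>R b))
           (at (s $ j) within {0..1})" using D s by blast
      from partial_deriv_eqI[OF *] s have "partial_deriv x s j = (\<Sum>b\<in>B. D b j s *\<^sub>R b)" by simp
      moreover have "partial_deriv (A \<circ> x) s j = A (\<Sum>b\<in>B. D b j s *\<^sub>R b)"
        using bounded_linear.has_vector_derivative[OF A *] s by (intro partial_deriv_eqI) simp_all
      ultimately show ?thesis by simp
    qed
    then have "partial_deriv (A \<circ> x) s = A \<circ> partial_deriv x s"
      by auto
    then show "dhat (A \<circ> x) s = ext_map A (dhat x s)"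
      by (simp add: dhat_def ext_map_characterization[OF assms(2)])
  qed
qed

lemma lip_maps_linear_image:
  fixes A :: "'v::real_inner \<Rightarrow> 'w::real_inner" and x :: "real^'d::finite \<Rightarrow> 'v"
  assumes "finite_dimensional TYPE('v)" "linear A" "x \<in> lip_maps"
  shows "A \<circ> x \<in> lip_maps"
proof -
  interpret bounded_linear A
    by (rule bounded_linear_finite_dimensional[OF assms(1,2)])
  obtain L where lip: "L-lipschitz_on unit_cube x"
    using assms(3) by (auto simp: lip_maps_def)
  obtain K where "0 \<le> K" "\<And>z. norm (A z) \<le> norm z * K"
    using nonneg_bounded by blast
  then have "K-lipschitz_on (x ` unit_cube) A"
    by (intro lipschitz_onI) (auto simp: dist_norm mult.commute simp flip: diff)
  from lipschitz_on_compose[OF lip this] show ?thesis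
    by (auto simp: lip_maps_def comp_def)
qed


section \<open>Expansions and integrals of tensors\<close>

text \<open>A nonzero difference extends to a basis, so some linear functional takes the value 1 on
  it. This makes tensor integrals unique.\<close>

lemma eq_by_linear_functionals:
  fixes x y :: "'a::real_vector"
  assumes "\<And>l :: 'a \<Rightarrow> real. linear l \<Longrightarrow> l x = l y"
  shows "x = y"
proof (rule ccontr)
  assume "x \<noteq> y"
  then have "independent {x - y}" by simp
  then obtain l :: "'a \<Rightarrow> real" where "linear l" "\<forall>z\<in>{x - y}. l z = 1"
    using linear_independent_extend[of "{x - y}" "\<lambda>_. 1"] by blast
  then show False
    using assms[of l] by (simp add: linear_diff)
qed

lemma tensor_integral_eqI:
  assumes "has_tensor_integral M D f I"
  shows "tensor_integral M D f = I"
  unfolding tensor_integral_def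
proof (rule the_equality[where P="has_tensor_integral M D f"])
  fix J assume "has_tensor_integral M D f J"
  with assms have "l J = l I" if "linear l" for l :: "'b tensor \<Rightarrow> real"
    using that unfolding has_tensor_integral_def by metis
  then show "J = I" by (rule eq_by_linear_functionals)
qed (rule assms)

text \<open>The multi-indices of an expanded tensor product, kept as lists to match the argument of
  \<open>tensor_prod\<close>.\<close>

definition words :: "'a set \<Rightarrow> nat \<Rightarrow> 'a list set" where
  "words S n = {w. set w \<subseteq> S \<and> length w = n}"

lemma finite_words: "finite S \<Longrightarrow> finite (words S n)"
  unfolding words_def by (rule finite_lists_length_eq)

lemma card_words: "finite S \<Longrightarrow> card (words S n) = card S ^ n"
  unfolding words_def by (rule card_lists_length_eq)

lemma sum_words_Suc:
  "(\<Sum>w\<in>words S (Suc n). f w) = (\<Sum>i\<in>S. \<Sum>w\<in>words S n. f (i # w))"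
proof -
  have eq: "words S (Suc n) = (\<lambda>(i, w). i # w) ` (S \<times> words S n)"
    by (auto simp: words_def image_iff length_Suc_conv)
  show ?thesis
    unfolding eq by (subst sum.reindex) (auto simp: inj_on_def sum.cartesian_product case_prod_unfold)
qed

lemma tensor_prod_insert_sum:
  assumes "finite S"
  shows "tensor_prod (xs @ (\<Sum>i\<in>S. c i *\<^sub>R e i) # ys) = (\<Sum>i\<in>S. c i *\<^sub>R tensor_prod (xs @ e i # ys))"
proof -
  have lin: "linear (\<lambda>z. tensor_prod (xs @ z # ys))"
    using tensor_prod_multilinear[of xs 1 _ 1 _ ys] tensor_prod_multilinear[of xs _ _ 0 _ ys]
    by (intro linearI) simp_all
  show ?thesis
    by (simp add: linear_sum[OF lin] linear_cmul[OF lin])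
qed

text \<open>The prefix xs collects the factors whose letters are already chosen, which the induction
  over ks needs.\<close>

lemma tensor_prod_expansion:
  assumes "finite S" and u: "\<And>k. k \<in> set ks \<Longrightarrow> u k = (\<Sum>i\<in>S. c k i *\<^sub>R e i)"
  shows "tensor_prod (xs @ map u ks) =
    (\<Sum>w\<in>words S (length ks). prod_list (map2 c ks w) *\<^sub>R tensor_prod (xs @ map e w))"
  using u
proof (induction ks arbitrary: xs)
  case Nil
  have "words S 0 = {[]}" by (auto simp: words_def)
  then show ?case by simp
next
  case (Cons k ks)
  have "tensor_prod (xs @ map u (k # ks)) = (\<Sum>i\<in>S. c k i *\<^sub>R tensor_prod ((xs @ [e i]) @ map u ks))"
    using Cons.prems by (simp add: tensor_prod_insert_sum[OF \<open>finite S\<close>])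
  also have "\<dots> = (\<Sum>i\<in>S. c k i *\<^sub>R (\<Sum>w\<in>words S (length ks).
      prod_list (map2 c ks w) *\<^sub>R tensor_prod ((xs @ [e i]) @ map e w)))"
    by (intro sum.cong arg_cong2[where f=scaleR] Cons.IH refl) (use Cons.prems in auto)
  also have "\<dots> = (\<Sum>w\<in>words S (length (k # ks)).
      prod_list (map2 c (k # ks) w) *\<^sub>R tensor_prod (xs @ map e w))"
    by (simp add: sum_words_Suc scaleR_sum_right)
  finally show ?case .
qed

text \<open>In a complete measure, changing a function on a null set preserves measurability. The
  integrands of the signature are only known to agree almost everywhere with measurable
  ones.\<close>

lemma borel_measurable_completion_AE_cong:
  fixes f g :: "'a \<Rightarrow> real"
  assumes f: "f \<in> borel_measurable (completion M)" and ae: "AE t in completion M. g t = f t"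
  shows "g \<in> borel_measurable (completion M)"
proof (rule borel_measurableI)
  fix S :: "real set" assume "open S"
  then have "f -` S \<inter> space (completion M) \<in> sets (completion M)"
    using f by (intro measurable_sets) auto
  then show "g -` S \<inter> space (completion M) \<in> sets (completion M)"
    by (rule completion.in_sets_AE[rotated]) (use ae in \<open>auto elim: eventually_mono\<close>)
qed

text \<open>A functional l turns the expansion into a sum of scalar functions g w with constant
  weights l (E w), so the integral can be taken coefficient by coefficient.\<close>

lemma has_tensor_integral_expansion:
  fixes f :: "'t \<Rightarrow> 'u::real_vector tensor"
  assumes int: "\<And>w. w \<in> W \<Longrightarrow> set_integrable (completion M) D (g w)"
    and ae: "AE t in M. t \<in> D \<longrightarrow> f t = (\<Sum>w\<in>W. g w t *\<^sub>R E w)"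
  shows "has_tensor_integral (completion M) D f (\<Sum>w\<in>W. (LINT t:D|completion M. g w t) *\<^sub>R E w)"
  unfolding has_tensor_integral_def
proof (intro allI impI)
  fix l :: "'u tensor \<Rightarrow> real" assume l: "linear l"
  let ?h = "\<lambda>t. indicator D t *\<^sub>R l (f t)"
  let ?k = "\<lambda>t. \<Sum>w\<in>W. (indicator D t *\<^sub>R g w t) * l (E w)"
  have k: "integrable (completion M) ?k"
    using int unfolding set_integrable_def by (intro Bochner_Integration.integrable_sum integrable_mult_left) auto
  have hk: "AE t in completion M. ?h t = ?k t"
    using AE_completion[OF ae]
    by (rule eventually_mono)
       (auto simp: linear_sum[OF l] linear_cmul[OF l] split: split_indicator)
  have h: "?h \<in> borel_measurable (completion M)"
    by (rule borel_measurable_completion_AE_cong[OF _ hk]) (rule borel_measurable_integrable[OF k])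
  have "integrable (completion M) ?h"
    using integrable_cong_AE[OF h borel_measurable_integrable[OF k] hk] k by blast
  moreover have "(LINT t|completion M. ?h t) = (LINT t|completion M. ?k t)"
    by (rule integral_cong_AE[OF h borel_measurable_integrable[OF k] hk])
  moreover have "\<dots> = (\<Sum>w\<in>W. (LINT t:D|completion M. g w t) * l (E w))"
    using int unfolding set_integrable_def set_lebesgue_integral_def
    by (subst Bochner_Integration.integral_sum) (auto intro!: integrable_mult_left)
  ultimately show "set_integrable (completion M) D (\<lambda>t. l (f t)) \<and>
      (LINT t:D|completion M. l (f t)) = l (\<Sum>w\<in>W. (LINT t:D|completion M. g w t) *\<^sub>R E w)"
    by (simp add: set_integrable_def set_lebesgue_integral_def linear_sum[OF l] linear_cmul[OF l])
qed

lemma has_tensor_integral_cong_AE: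
  assumes "has_tensor_integral (completion M) D f I" and "AE t in M. t \<in> D \<longrightarrow> f t = g t"
  shows "has_tensor_integral (completion M) D g I"
  unfolding has_tensor_integral_def
proof (intro allI impI)
  fix l :: "'b tensor \<Rightarrow> real" assume l: "linear l"
  let ?f = "\<lambda>t. indicator D t *\<^sub>R l (f t)" and ?g = "\<lambda>t. indicator D t *\<^sub>R l (g t)"
  have f: "integrable (completion M) ?f" "(LINT t|completion M. ?f t) = l I"
    using assms(1) l unfolding has_tensor_integral_def set_integrable_def set_lebesgue_integral_def by auto
  have ae: "AE t in completion M. ?g t = ?f t"
    using AE_completion[OF assms(2)] by (rule eventually_mono) (auto split: split_indicator)
  have g: "?g \<in> borel_measurable (completion M)"
    by (rule borel_measurable_completion_AE_cong[OF _ ae]) (rule borel_measurable_integrable[OF f(1)])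
  show "set_integrable (completion M) D (\<lambda>t. l (g t)) \<and> (LINT t:D|completion M. l (g t)) = l I"
    unfolding set_integrable_def set_lebesgue_integral_def
    using integrable_cong_AE[OF g borel_measurable_integrable[OF f(1)] ae]
      integral_cong_AE[OF g borel_measurable_integrable[OF f(1)] ae] f by simp
qed

text \<open>Testing T (f t) against l is testing f t against l \<circ> T, which is among the
  functionals that the definition quantifies over.\<close>

lemma has_tensor_integral_linear_image:
  assumes "has_tensor_integral M D f I" and "linear T"
  shows "has_tensor_integral M D (\<lambda>t. T (f t)) (T I)"
  using assms linear_compose[OF assms(2)] unfolding has_tensor_integral_def comp_def by blast

text \<open>There are card S ^ (2 * m) pairs of words, and each pair contributes a product of m
  inner products. This crude count grows only geometrically in m, which the factorial in the volume
  bound will absorb.\<close>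

lemma tensor_inner_expansion_bound:
  fixes g :: "'u::real_vector \<Rightarrow> 'u \<Rightarrow> real"
  assumes g: "bilinear g" "\<And>u w. g u w = g w u" and S: "finite S"
    and K: "\<And>i j. i \<in> S \<Longrightarrow> j \<in> S \<Longrightarrow> \<bar>g (e i) (e j)\<bar> \<le> K"
    and a: "\<And>w. w \<in> words S m \<Longrightarrow> \<bar>a w\<bar> \<le> r"
  defines "\<xi> \<equiv> \<Sum>w\<in>words S m. a w *\<^sub>R tensor_prod (map e w)"
  shows "\<bar>tensor_inner g \<xi> \<xi>\<bar> \<le> ((real (card S))\<^sup>2 * K) ^ m * r\<^sup>2"
proof -
  note ti = tensor_inner_characterization[OF g]
  have prod: "\<bar>tensor_inner g (tensor_prod (map e v)) (tensor_prod (map e w))\<bar> \<le> K ^ m"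
    if "v \<in> words S m" "w \<in> words S m" for v w
  proof -
    have len: "length v = m" "length w = m" and sub: "set v \<subseteq> S" "set w \<subseteq> S"
      using that by (auto simp: words_def)
    have "\<bar>\<Prod>i<m. g (map e v ! i) (map e w ! i)\<bar> \<le> (\<Prod>i<m. K)"
      unfolding abs_prod
    proof (intro prod_mono conjI abs_ge_zero)
      fix i assume "i \<in> {..<m}"
      then have i: "i < length v" "i < length w" using len by auto
      then have "v ! i \<in> S" "w ! i \<in> S"
        using sub nth_mem by blast+
      then show "\<bar>g (map e v ! i) (map e w ! i)\<bar> \<le> K"
        using i K by simp
    qed
    then show ?thesis by (simp add: ti(2) len)
  qed
  have "tensor_inner g \<xi> \<xi> = (\<Sum>(v, w)\<in>words S m \<times> words S m.
      a v * a w * tensor_inner g (tensor_prod (map e v)) (tensor_prod (map e w)))"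
    unfolding \<xi>_def by (subst bilinear_sum[OF ti(1)])
      (simp add: bilinear_lmul[OF ti(1)] bilinear_rmul[OF ti(1)] mult_ac)
  also have "\<bar>\<dots>\<bar> \<le> (\<Sum>(v, w)\<in>words S m \<times> words S m.
      \<bar>a v * a w * tensor_inner g (tensor_prod (map e v)) (tensor_prod (map e w))\<bar>)"
    unfolding case_prod_unfold by (rule sum_abs)
  also have "\<dots> \<le> (\<Sum>(v, w)\<in>words S m \<times> words S m. r * r * K ^ m)"
  proof (rule sum_mono, clarify)
    fix v w assume vw: "v \<in> words S m" "w \<in> words S m"
    have "0 \<le> r" using a[OF vw(1)] by linarith
    then show "\<bar>a v * a w * tensor_inner g (tensor_prod (map e v)) (tensor_prod (map e w))\<bar> \<le> r * r * K ^ m"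
      unfolding abs_mult using a vw prod by (intro mult_mono) auto
  qed
  also have "\<dots> = ((real (card S))\<^sup>2 * K) ^ m * r\<^sup>2"
    by (simp add: card_cartesian_product card_words[OF S] power_mult_distrib power2_eq_square)
  finally show ?thesis .
qed


section \<open>Volumes of the integration domains\<close>

text \<open>Otherwise the simplifier turns the index set \<open>{1..m}\<close> into \<open>{Suc 0..m}\<close>.\<close>

declare One_nat_def [simp del]

lemma order_simplex_strict_mono:
  assumes u: "u \<in> order_simplex m p" and i: "1 \<le> i" and "i < k" "k \<le> m"
  shows "u (p i) < u (p k)"
proof -
  have adj: "u (p n) < u (p (Suc n))" if "1 \<le> n" "n < m" for n
    using u that by (simp add: order_simplex_def)
  have "Suc i \<le> k" using \<open>i < k\<close> by simp
  then show ?thesis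
    using \<open>k \<le> m\<close>
  proof (induction k rule: dec_induct)
    case base
    then show ?case using adj[of i] i by simp
  next
    case (step n)
    have "u (p n) < u (p (Suc n))"
      using adj[of n] step.hyps step.prems by simp
    with step show ?case by simp
  qed
qed

lemma order_simplex_bounds:
  assumes u: "u \<in> order_simplex m p" and p: "p permutes {1..m}" and i: "i \<in> {1..m}"
  shows "u i \<in> {0..1}"
proof -
  obtain k where k: "k \<in> {1..m}" "i = p k"
    using permutes_image[OF p] i by blast
  have "u (p 1) \<le> u (p k)"
    using order_simplex_strict_mono[OF u, of 1 k] k by (cases "k = 1") auto
  moreover have "u (p k) \<le> u (p m)"
    using order_simplex_strict_mono[OF u, of k m] k by (cases "k = m") auto
  ultimately show ?thesis
    using u k by (auto simp: order_simplex_def)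
qed

text \<open>In both orderings the position of an index is determined by the rank of its value.\<close>

lemma order_simplex_unique:
  assumes u: "u \<in> order_simplex m p" "u \<in> order_simplex m q"
    and pq: "p permutes {1..m}" "q permutes {1..m}"
  shows "p = q"
proof -
  have rank: "card {i' \<in> {1..m}. u i' < u (p k)} = k - 1"
    if simplex: "u \<in> order_simplex m p" and perm: "p permutes {1..m}" and k: "k \<in> {1..m}" for p k
  proof -
    have "{i' \<in> {1..m}. u i' < u (p k)} = p ` {1..<k}"
    proof (intro equalityI subsetI)
      fix i assume i: "i \<in> {i' \<in> {1..m}. u i' < u (p k)}"
      then obtain l where l: "l \<in> {1..m}" "i = p l"
        using permutes_image[OF perm] by blast
      have "\<not> k \<le> l"
        using i l order_simplex_strict_mono[OF simplex, of k l] k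
        by (cases "k = l") auto
      with l show "i \<in> p ` {1..<k}" by auto
    next
      fix i assume "i \<in> p ` {1..<k}"
      then obtain l where l: "1 \<le> l" "l < k" "i = p l" by auto
      then have "p l \<in> {1..m}"
        using permutes_in_image[OF perm, of l] k by auto
      with l show "i \<in> {i' \<in> {1..m}. u i' < u (p k)}"
        using order_simplex_strict_mono[OF simplex, of l k] k by auto
    qed
    then show ?thesis
      using card_image[OF permutes_inj_on[OF perm, of "{1..<k}"]]
      by simp
  qed
  show ?thesis
  proof
    fix k
    show "p k = q k"
    proof (cases "k \<in> {1..m}")
      case True
      then have "p k \<in> {1..m}"
        using permutes_in_image[OF pq(1), of k] by simp
      then obtain l where l: "l \<in> {1..m}" "p k = q l"
        using permutes_image[OF pq(2)] by blast
      have "k - 1 = l - 1"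
        using rank[OF u(1) pq(1) True] rank[OF u(2) pq(2) l(1)] l(2) by simp
      with True l have "k = l" by auto
      with l show ?thesis by simp
    next
      case False
      then show ?thesis
        using pq by (simp add: permutes_def)
    qed
  qed
qed

abbreviation borel_rows :: "nat \<Rightarrow> (nat \<Rightarrow> real^'d::finite) measure" where
  "borel_rows m \<equiv> Pi\<^sub>M {1..m} (\<lambda>_. lborel)"

interpretation rows: product_sigma_finite "\<lambda>_::nat. lborel :: (real^'d::finite) measure"
  by standard

lemma emeasure_cube_power:
  "emeasure (borel_rows m) ({1..m} \<rightarrow>\<^sub>E (unit_cube :: (real^'d::finite) set)) = 1"
proof -
  have "emeasure lborel (unit_cube :: (real^'d) set) = 1"
  proof -
    have le: "(0::real^'d) \<bullet> b \<le> 1 \<bullet> b" and one: "(1::real^'d) \<bullet> b = 1" if "b \<in> Basis" for b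
      using that by (auto simp: Basis_vec_def inner_axis)
    then show ?thesis
      by (subst emeasure_lborel_cbox) auto
  qed
  then show ?thesis
    by (subst rows.emeasure_PiM) auto
qed

lemma D_domain_in_cube:
  assumes "\<pi> \<in> perm_families m"
  shows "D_domain m \<pi> \<subseteq> {1..m} \<rightarrow>\<^sub>E unit_cube"
proof
  fix t assume t: "t \<in> D_domain m \<pi>"
  have "t i \<in> unit_cube" if "i \<in> {1..m}" for i
    using order_simplex_bounds[of "\<lambda>i. t i $ j" m "\<pi> j" i for j] t assms that
    by (auto simp: D_domain_def perm_families_def mem_box_cart)
  with t show "t \<in> {1..m} \<rightarrow>\<^sub>E unit_cube"
    by (auto simp: D_domain_def PiE_iff)
qed

text \<open>As m is at least 1, the indices p 1 and p m lie in \<open>{1..m}\<close>, so every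
  condition compares measurable coordinates.\<close>

lemma sets_order_simplex_column:
  fixes j :: "'d::finite"
  assumes p: "p permutes {1..m}" and "1 \<le> m"
  shows "{t \<in> space (borel_rows m). (\<lambda>i. t i $ j) \<in> order_simplex m p} \<in> sets (borel_rows m)"
proof -
  have "p i \<in> {1..m}" if "i \<in> {1..m}" for i
    using permutes_in_image[OF p] that by blast
  then have col: "(\<lambda>t. t (p i) $ j) \<in> borel_measurable (borel_rows m)" if "i \<in> {1..m}" for i
    using that
    by (intro measurable_compose[OF measurable_component_singleton[of "p i"]])
       (auto intro!: borel_measurable_continuous_onI continuous_intros)
  have [measurable]: "(\<lambda>t. t (p 1) $ j) \<in> borel_measurable (borel_rows m)"
    "(\<lambda>t. t (p m) $ j) \<in> borel_measurable (borel_rows m)"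
    using \<open>1 \<le> m\<close> by (auto intro: col)
  have eq: "{t \<in> space (borel_rows m). (\<lambda>i. t i $ j) \<in> order_simplex m p} =
      {t \<in> space (borel_rows m). 0 \<le> t (p 1) $ j} \<inter>
      {t \<in> space (borel_rows m). \<forall>i\<in>{1..<m}. t (p i) $ j < t (p (Suc i)) $ j} \<inter>
      {t \<in> space (borel_rows m). t (p m) $ j \<le> 1}"
    by (auto simp: order_simplex_def)
  have "{t \<in> space (borel_rows m). \<forall>i\<in>{1..<m}. t (p i) $ j < t (p (Suc i)) $ j} \<in> sets (borel_rows m)"
    by (intro sets.sets_Collect_finite_All borel_measurable_less col) auto
  moreover have "{t \<in> space (borel_rows m). 0 \<le> t (p 1) $ j} \<in> sets (borel_rows m)"
    "{t \<in> space (borel_rows m). t (p m) $ j \<le> 1} \<in> sets (borel_rows m)"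
    by measurable
  ultimately show ?thesis
    unfolding eq by (intro sets.Int)
qed

lemma sets_D_domain:
  fixes \<pi> :: "'d::finite \<Rightarrow> nat \<Rightarrow> nat"
  assumes "\<pi> \<in> perm_families m" "1 \<le> m"
  shows "D_domain m \<pi> \<in> sets (borel_rows m)"
proof -
  have "D_domain m \<pi> = (\<Inter>j. {t \<in> space (borel_rows m). (\<lambda>i. t i $ j) \<in> order_simplex m (\<pi> j)})"
    by (auto simp: D_domain_def space_PiM)
  also have "\<dots> \<in> sets (borel_rows m)"
    using assms by (intro sets.finite_INT sets_order_simplex_column) (auto simp: perm_families_def)
  finally show ?thesis .
qed

section \<open>Permuting the rows preserves volume\<close>

text \<open>Product measure is determined by boxes. The preimage of a box is the box with its sides
  permuted by \<open>inv p\<close>, and a finite product does not depend on the order of its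
  factors.\<close>

lemma distr_rows_permute:
  assumes p: "p permutes {1..m}"
  shows "distr (borel_rows m) (borel_rows m) (\<lambda>t. \<lambda>i\<in>{1..m}. t (p i)) =
    (borel_rows m :: (nat \<Rightarrow> real^'d::finite) measure)"
proof (rule rows.PiM_eqI)
  have pin: "p i \<in> {1..m}" if "i \<in> {1..m}" for i
    using permutes_in_image[OF p] that by blast
  have meas: "(\<lambda>t. \<lambda>i\<in>{1..m}. t (p i)) \<in> measurable (borel_rows m) (borel_rows m)"
    using pin by (intro measurable_restrict measurable_component_singleton) blast
  fix A :: "nat \<Rightarrow> (real^'d) set" assume A: "\<And>i. i \<in> {1..m} \<Longrightarrow> A i \<in> sets lborel"
  have inv: "inv p i \<in> {1..m}" if "i \<in> {1..m}" for i
    using permutes_in_image[OF permutes_inv[OF p]] that by blast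
  have "(\<lambda>t. \<lambda>i\<in>{1..m}. t (p i)) -` (Pi\<^sub>E {1..m} A) \<inter> space (borel_rows m) = Pi\<^sub>E {1..m} (\<lambda>i. A (inv p i))"
  proof (intro equalityI subsetI)
    fix t assume t: "t \<in> (\<lambda>t. \<lambda>i\<in>{1..m}. t (p i)) -` (Pi\<^sub>E {1..m} A) \<inter> space (borel_rows m)"
    have "t i \<in> A (inv p i)" if "i \<in> {1..m}" for i
    proof -
      have "(\<lambda>i\<in>{1..m}. t (p i)) (inv p i) \<in> A (inv p i)"
        using t inv[OF that] by blast
      then show ?thesis using inv[OF that] by (simp add: permutes_inverses(1)[OF p])
    qed
    with t show "t \<in> Pi\<^sub>E {1..m} (\<lambda>i. A (inv p i))"
      by (auto simp: space_PiM PiE_iff)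
  next
    fix t assume t: "t \<in> Pi\<^sub>E {1..m} (\<lambda>i. A (inv p i))"
    have "t (p i) \<in> A i" if "i \<in> {1..m}" for i
      using PiE_mem[OF t pin[OF that]] by (simp add: permutes_inverses(2)[OF p])
    with t show "t \<in> (\<lambda>t. \<lambda>i\<in>{1..m}. t (p i)) -` (Pi\<^sub>E {1..m} A) \<inter> space (borel_rows m)"
      by (auto simp: space_PiM PiE_iff)
  qed
  then have "emeasure (distr (borel_rows m) (borel_rows m) (\<lambda>t. \<lambda>i\<in>{1..m}. t (p i))) (Pi\<^sub>E {1..m} A) =
      emeasure (borel_rows m) (Pi\<^sub>E {1..m} (\<lambda>i. A (inv p i)))"
    using A by (subst emeasure_distr[OF meas]) (auto intro!: sets_PiM_I_finite)
  also have "\<dots> = (\<Prod>i\<in>{1..m}. emeasure lborel (A (inv p i)))"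
    using A inv by (intro rows.emeasure_PiM) auto
  also have "\<dots> = (\<Prod>i\<in>{1..m}. emeasure lborel (A i))"
    by (rule prod.permute[OF permutes_inv[OF p], of "\<lambda>i. emeasure lborel (A i)", unfolded comp_def, symmetric])
  finally show "emeasure (distr (borel_rows m) (borel_rows m) (\<lambda>t. \<lambda>i\<in>{1..m}. t (p i))) (Pi\<^sub>E {1..m} A) =
      (\<Prod>i\<in>{1..m}. emeasure lborel (A i))" .
qed auto

text \<open>A relaxation of \<open>D_domain\<close> that orders column j alone and leaves the other
  columns free in the cube. Unlike the domains for a general \<pi>, these sets are all carried to
  the one for \<open>id\<close> by permuting rows.\<close>

definition column_simplex :: "nat \<Rightarrow> 'd \<Rightarrow> (nat \<Rightarrow> nat) \<Rightarrow> (nat \<Rightarrow> real^'d::finite) set" where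
  "column_simplex m j p = {t \<in> {1..m} \<rightarrow>\<^sub>E unit_cube. (\<lambda>i. t i $ j) \<in> order_simplex m p}"

lemma sets_column_simplex:
  assumes "p permutes {1..m}" "1 \<le> m"
  shows "column_simplex m j p \<in> sets (borel_rows m)"
proof -
  have "column_simplex m j p = ({1..m} \<rightarrow>\<^sub>E unit_cube) \<inter>
      {t \<in> space (borel_rows m). (\<lambda>i. t i $ j) \<in> order_simplex m p}"
    by (auto simp: column_simplex_def space_PiM)
  also have "\<dots> \<in> sets (borel_rows m)"
    by (intro sets.Int sets_order_simplex_column assms sets_PiM_I_finite) auto
  finally show ?thesis .
qed

text \<open>Relabelling rows by p sends the column values in the order p to values in increasing
  order, so the set for p is the preimage of the set for \<open>id\<close> under a
  measure-preserving map.\<close>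

lemma emeasure_column_simplex_eq:
  fixes j :: "'d::finite"
  assumes p: "p permutes {1..m}" and "1 \<le> m"
  shows "emeasure (borel_rows m) (column_simplex m j p) = emeasure (borel_rows m) (column_simplex m j id)"
proof -
  have pin: "p i \<in> {1..m}" if "i \<in> {1..m}" for i
    using permutes_in_image[OF p] that by blast
  have meas: "(\<lambda>t. \<lambda>i\<in>{1..m}. t (p i)) \<in> measurable (borel_rows m) (borel_rows m)"
    using pin by (intro measurable_restrict measurable_component_singleton) blast
  have simplex: "(\<lambda>i. (\<lambda>i\<in>{1..m}. t (p i)) i $ j) \<in> order_simplex m id \<longleftrightarrow> (\<lambda>i. t i $ j) \<in> order_simplex m p"
    for t :: "nat \<Rightarrow> real^'d"
    using \<open>1 \<le> m\<close> by (auto simp: order_simplex_def)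
  have "(\<forall>i\<in>{1..m}. t (p i) \<in> unit_cube) \<longleftrightarrow> (\<forall>i\<in>{1..m}. t i \<in> unit_cube)" for t :: "nat \<Rightarrow> real^'d"
    using permutes_image[OF p] by (metis (no_types, lifting) image_iff pin)
  then have "(\<lambda>i\<in>{1..m}. t (p i)) \<in> column_simplex m j id \<longleftrightarrow>
      (\<forall>i\<in>{1..m}. t i \<in> unit_cube) \<and> (\<lambda>i. t i $ j) \<in> order_simplex m p" for t
    unfolding column_simplex_def mem_Collect_eq simplex restrict_PiE_iff by blast
  then have "(\<lambda>t. \<lambda>i\<in>{1..m}. t (p i)) -` column_simplex m j id \<inter> space (borel_rows m) = column_simplex m j p"
    by (auto simp: column_simplex_def space_PiM PiE_iff extensional_def)
  then have "emeasure (borel_rows m) (column_simplex m j p) =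
      emeasure (distr (borel_rows m) (borel_rows m) (\<lambda>t. \<lambda>i\<in>{1..m}. t (p i))) (column_simplex m j id)"
    by (subst emeasure_distr[OF meas]) (auto intro: sets_column_simplex permutes_id \<open>1 \<le> m\<close>)
  then show ?thesis by (simp add: distr_rows_permute[OF p])
qed

lemma measure_column_simplex_le:
  fixes j :: "'d::finite"
  assumes p: "p permutes {1..m}" and "1 \<le> m"
  shows "measure (borel_rows m) (column_simplex m j p) \<le> 1 / fact m"
proof -
  let ?P = "{p. p permutes {1..m}}" and ?v = "emeasure (borel_rows m) (column_simplex m j id)"
  have fin: "finite ?P" by (rule finite_permutations) simp
  have disj: "disjoint_family_on (column_simplex m j) ?P"
    unfolding disjoint_family_on_def column_simplex_def using order_simplex_unique by blast
  have "of_nat (fact m) * ?v = (\<Sum>p\<in>?P. emeasure (borel_rows m) (column_simplex m j p))"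
  proof -
    have "(\<Sum>p\<in>?P. emeasure (borel_rows m) (column_simplex m j p)) = (\<Sum>p\<in>?P. ?v)"
      using \<open>1 \<le> m\<close> by (intro sum.cong emeasure_column_simplex_eq) auto
    also have "\<dots> = of_nat (fact m) * ?v"
      using card_permutations[of "{1..m}" m] by simp
    finally show ?thesis by simp
  qed
  also have "\<dots> = emeasure (borel_rows m) (\<Union>p\<in>?P. column_simplex m j p)"
    using \<open>1 \<le> m\<close> by (intro sum_emeasure fin disj) (auto intro: sets_column_simplex)
  also have "\<dots> \<le> emeasure (borel_rows m) ({1..m} \<rightarrow>\<^sub>E (unit_cube :: (real^'d) set))"
    by (intro emeasure_mono sets_PiM_I_finite) (auto simp: column_simplex_def)
  finally have le: "of_nat (fact m) * ?v \<le> 1"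
    by (simp only: emeasure_cube_power)
  then have "ennreal (real (fact m)) * ?v \<le> 1"
    by (simp only: ennreal_of_nat_eq_real_of_nat)
  from enn2real_mono[OF this]
  have "measure (borel_rows m) (column_simplex m j id) * fact m \<le> 1"
    by (simp add: enn2real_mult measure_def mult.commute)
  moreover have "measure (borel_rows m) (column_simplex m j p) = measure (borel_rows m) (column_simplex m j id)"
    using emeasure_column_simplex_eq[OF assms, of j] by (simp add: measure_def)
  ultimately show ?thesis by (simp add: field_simps)
qed

lemma finite_perm_families: "finite (perm_families m :: ('d::finite \<Rightarrow> nat \<Rightarrow> nat) set)"
proof -
  have "perm_families m = (UNIV :: 'd set) \<rightarrow>\<^sub>E {p. p permutes {1..m}}"
    by (auto simp: perm_families_def PiE_iff)
  then show ?thesis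
    using finite_permutations[of "{1..m}"] by (simp add: finite_PiE)
qed

lemma emeasure_D_domain_finite:
  fixes \<pi> :: "'d::finite \<Rightarrow> nat \<Rightarrow> nat"
  assumes "\<pi> \<in> perm_families m"
  shows "emeasure (borel_rows m) (D_domain m \<pi>) < \<infinity>"
proof -
  have "emeasure (borel_rows m) (D_domain m \<pi>) \<le> emeasure (borel_rows m) ({1..m} \<rightarrow>\<^sub>E (unit_cube :: (real^'d) set))"
    by (intro emeasure_mono D_domain_in_cube assms sets_PiM_I_finite) auto
  then show ?thesis
    unfolding emeasure_cube_power by (rule le_less_trans) simp
qed

text \<open>A sum of squares is at most the largest term times the sum: every volume is at most 1 /
  fact m, and disjointness inside the cube bounds the total by 1. The number of families \<pi>
  therefore never enters.\<close>

lemma sum_measure_D_domain_sq_le: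
  assumes "1 \<le> m"
  shows "(\<Sum>\<pi>\<in>perm_families m. (measure (borel_rows m) (D_domain m (\<pi> :: 'd::finite \<Rightarrow> nat \<Rightarrow> nat)))\<^sup>2) \<le> 1 / fact m"
proof -
  let ?\<mu> = "measure (borel_rows m :: (nat \<Rightarrow> real^'d) measure)"
  let ?F = "perm_families m :: ('d \<Rightarrow> nat \<Rightarrow> nat) set"
  let ?C = "{1..m} \<rightarrow>\<^sub>E (unit_cube :: (real^'d) set)"
  have C: "?C \<in> fmeasurable (borel_rows m)"
    by (intro fmeasurableI sets_PiM_I_finite) (auto simp: emeasure_cube_power)
  have D: "D_domain m \<pi> \<in> fmeasurable (borel_rows m)" if "\<pi> \<in> ?F" for \<pi>
    using sets_D_domain emeasure_D_domain_finite that \<open>1 \<le> m\<close> by (intro fmeasurableI) auto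
  have single: "?\<mu> (D_domain m \<pi>) \<le> 1 / fact m" if \<pi>: "\<pi> \<in> ?F" for \<pi>
  proof -
    \<comment> \<open>Any column will do; one exists because types are nonempty, which encodes d at
      least 1.\<close>
    fix j :: 'd
    have perm: "\<pi> j permutes {1..m}" using \<pi> by (simp add: perm_families_def)
    have col: "column_simplex m j (\<pi> j) \<in> sets (borel_rows m)"
      by (rule sets_column_simplex[OF perm \<open>1 \<le> m\<close>])
    have "?\<mu> (D_domain m \<pi>) \<le> ?\<mu> (column_simplex m j (\<pi> j))"
    proof (rule measure_mono_fmeasurable)
      show "D_domain m \<pi> \<subseteq> column_simplex m j (\<pi> j)"
        using D_domain_in_cube[OF \<pi>] by (auto simp: D_domain_def column_simplex_def)
      show "column_simplex m j (\<pi> j) \<in> fmeasurable (borel_rows m)"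
        by (rule fmeasurableI2[OF C _ col]) (auto simp: column_simplex_def)
    qed (rule fmeasurableD[OF D[OF \<pi>]])
    also have "\<dots> \<le> 1 / fact m"
      by (rule measure_column_simplex_le[OF perm \<open>1 \<le> m\<close>])
    finally show "?\<mu> (D_domain m \<pi>) \<le> 1 / fact m" .
  qed
  have "(\<Sum>\<pi>\<in>?F. ?\<mu> (D_domain m \<pi>)) \<le> 1"
  proof -
    have disj: "disjoint_family_on (D_domain m) ?F"
    proof -
      have "\<pi> = \<pi>'" if "\<pi> \<in> ?F" "\<pi>' \<in> ?F" "t \<in> D_domain m \<pi>" "t \<in> D_domain m \<pi>'" for \<pi> \<pi>' t
      proof
        show "\<pi> j = \<pi>' j" for j
          by (rule order_simplex_unique[of "\<lambda>i. t i $ j" m])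
             (use that in \<open>auto simp: D_domain_def perm_families_def\<close>)
      qed
      then show ?thesis unfolding disjoint_family_on_def by blast
    qed
    have "(\<Sum>\<pi>\<in>?F. ?\<mu> (D_domain m \<pi>)) = ?\<mu> (\<Union>\<pi>\<in>?F. D_domain m \<pi>)"
      using D emeasure_D_domain_finite disj
      by (intro measure_finite_Union[symmetric] finite_perm_families) (auto simp: fmeasurableD less_top[symmetric])
    also have "\<dots> \<le> ?\<mu> ?C"
      using D_domain_in_cube D C
      by (intro measure_mono_fmeasurable sets.finite_UN finite_perm_families) (auto simp: fmeasurableD)
    also have "\<dots> = 1" by (simp add: measure_def emeasure_cube_power)
    finally show ?thesis .
  qed
  then have "1 / fact m * (\<Sum>\<pi>\<in>?F. ?\<mu> (D_domain m \<pi>)) \<le> 1 / fact m"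
    by (simp add: divide_right_mono)
  moreover have "(\<Sum>\<pi>\<in>?F. (?\<mu> (D_domain m \<pi>))\<^sup>2) \<le> 1 / fact m * (\<Sum>\<pi>\<in>?F. ?\<mu> (D_domain m \<pi>))"
    unfolding sum_distrib_left power2_eq_square
    by (intro sum_mono mult_right_mono single) auto
  ultimately show ?thesis by linarith
qed


section \<open>The signature\<close>

text \<open>The exceptional set for row i is a cylinder over a null set.\<close>

lemma AE_rows:
  fixes P :: "real^'d::finite \<Rightarrow> bool"
  assumes "AE s in lborel. P s"
  shows "AE t in borel_rows m. \<forall>i\<in>{1..m}. P (t i)"
proof (rule AE_finite_allI)
  fix i assume i: "i \<in> {1..m}"
  obtain N where N: "{s \<in> space lborel. \<not> P s} \<subseteq> N" "emeasure lborel N = 0" "N \<in> sets (lborel :: (real^'d) measure)"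
    using assms by (rule AE_E)
  let ?A = "\<lambda>k. if k = i then N else UNIV"
  have "emeasure (borel_rows m) (Pi\<^sub>E {1..m} ?A) = (\<Prod>k\<in>{1..m}. emeasure lborel (?A k))"
    using N by (intro rows.emeasure_PiM) auto
  \<comment> \<open>The other sides have infinite measure; in \<open>ennreal\<close> a zero factor
    still annihilates the product.\<close>
  also have "\<dots> = 0"
    using i N by (intro prod_zero) auto
  finally have "Pi\<^sub>E {1..m} ?A \<in> null_sets (borel_rows m)"
    using N by (intro null_setsI sets_PiM_I_finite) auto
  then show "AE t in borel_rows m. P (t i)"
  proof (rule AE_I')
    show "{t \<in> space (borel_rows m). \<not> P (t i)} \<subseteq> Pi\<^sub>E {1..m} ?A"
      using N(1) by (auto simp: space_PiM PiE_iff extensional_def)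
  qed
qed simp

lemma AE_D_domain:
  fixes P :: "real^'d::finite \<Rightarrow> bool"
  assumes "AE s in lborel. s \<in> unit_cube \<longrightarrow> P s" and "\<pi> \<in> perm_families m"
  shows "AE t in borel_rows m. t \<in> D_domain m \<pi> \<longrightarrow> (\<forall>i\<in>{1..m}. P (t i))"
  using AE_rows[OF assms(1), of m] D_domain_in_cube[OF assms(2)]
  by (auto elim!: eventually_mono)

lemma borel_measurable_word_product:
  fixes c :: "'i \<Rightarrow> real^'d::finite \<Rightarrow> real"
  assumes c: "\<And>\<phi>. \<phi> \<in> S \<Longrightarrow> c \<phi> \<in> borel_measurable borel"
    and "set ks \<subseteq> {1..m}" "set w \<subseteq> S"
  shows "(\<lambda>t. prod_list (map2 (\<lambda>i \<phi>. c \<phi> (t i)) ks w)) \<in> borel_measurable (borel_rows m)"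
  using assms(2,3)
proof (induction ks arbitrary: w)
  case Nil
  then show ?case by simp
next
  case (Cons k ks)
  show ?case
  proof (cases w)
    case Nil
    then show ?thesis by simp
  next
    case (Cons \<phi> w')
    have "(\<lambda>t. t k) \<in> measurable (borel_rows m) (borel :: (real^'d) measure)"
      using measurable_component_singleton[of k "{1..m}" "\<lambda>_. lborel"] Cons.prems(1) by simp
    then have "(\<lambda>t. c \<phi> (t k)) \<in> borel_measurable (borel_rows m)"
      by (rule measurable_compose) (use c Cons Cons.prems in auto)
    then show ?thesis
      using Cons Cons.prems Cons.IH[of w'] by simp
  qed
qed

lemma word_product_bound:
  fixes f :: "'k \<Rightarrow> 'i \<Rightarrow> real"
  assumes "\<And>k \<phi>. \<phi> \<in> S \<Longrightarrow> \<bar>f k \<phi>\<bar> \<le> C" "w \<in> words S (length ks)"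
  shows "\<bar>prod_list (map2 f ks w)\<bar> \<le> C ^ length ks"
  using assms(2)
proof (induction ks arbitrary: w)
  case Nil
  then show ?case by simp
next
  case (Cons k ks)
  then obtain \<phi> w' where w: "w = \<phi> # w'" "\<phi> \<in> S" "w' \<in> words S (length ks)"
    by (auto simp: words_def length_Suc_conv)
  have "0 \<le> C" using assms(1)[OF w(2)] by (meson abs_ge_zero order_trans)
  then show ?case
    using w assms(1) Cons.IH[OF w(3)] by (auto simp: abs_mult intro!: mult_mono)
qed

text \<open>Multiplying out the m factors leaves one bounded scalar coefficient per word. Existence
  of the integral and the size of its coefficients, the latter needed for square summability, come
  out together.\<close>

lemma signature_integral_expansion:
  fixes g :: "real^'d::finite \<Rightarrow> 'u::real_vector" and c :: "'i \<Rightarrow> real^'d \<Rightarrow> real"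
  assumes "1 \<le> m" and \<pi>: "\<pi> \<in> perm_families m" and S: "finite S"
    and c: "\<And>\<phi>. \<phi> \<in> S \<Longrightarrow> c \<phi> \<in> borel_measurable borel" "\<And>\<phi> s. \<phi> \<in> S \<Longrightarrow> \<bar>c \<phi> s\<bar> \<le> C"
    and rep: "AE s in lborel. s \<in> unit_cube \<longrightarrow> g s = (\<Sum>\<phi>\<in>S. c \<phi> s *\<^sub>R e \<phi>)"
  obtains a where
    "\<And>w. w \<in> words S m \<Longrightarrow> \<bar>a w\<bar> \<le> C ^ m * measure (borel_rows m) (D_domain m \<pi>)"
    "has_tensor_integral (lebesgue_rows m) (D_domain m \<pi>)
       (\<lambda>t. tensor_prod (map (\<lambda>i. g (t i)) [1..<Suc m]))
       (\<Sum>w\<in>words S m. a w *\<^sub>R tensor_prod (map e w))"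
proof -
  let ?D = "D_domain m \<pi>" and ?ks = "[1..<Suc m]"
  have D: "?D \<in> sets (borel_rows m)"
    by (rule sets_D_domain[OF \<pi> \<open>1 \<le> m\<close>])
  have Dfin: "emeasure (lebesgue_rows m) ?D < \<infinity>"
    using emeasure_D_domain_finite[OF \<pi>] D by simp
  \<comment> \<open>The constant C ^ m on the domain dominates every coefficient.\<close>
  have Dint: "integrable (lebesgue_rows m) (\<lambda>t. indicator ?D t *\<^sub>R C ^ m)"
    using D Dfin by (intro integrable_scaleR_left integrable_real_indicator) auto
  define G where "G w t = prod_list (map2 (\<lambda>i \<phi>. c \<phi> (t i)) ?ks w)" for w and t :: "nat \<Rightarrow> real^'d"
  have Gbound: "\<bar>G w t\<bar> \<le> C ^ m" if "w \<in> words S m" for w t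
    using word_product_bound[of S "\<lambda>i \<phi>. c \<phi> (t i)" C w ?ks] c(2) that
    by (simp add: G_def del: upt_Suc)
  have Gint: "integrable (lebesgue_rows m) (\<lambda>t. indicator ?D t *\<^sub>R G w t)" if w: "w \<in> words S m" for w
  proof (rule Bochner_Integration.integrable_bound[OF Dint])
    have "G w \<in> borel_measurable (borel_rows m)"
      unfolding G_def using w
      by (intro borel_measurable_word_product[of S]) (auto simp: c words_def)
    then show "(\<lambda>t. indicator ?D t *\<^sub>R G w t) \<in> borel_measurable (lebesgue_rows m)"
      using D by (intro measurable_completion borel_measurable_scaleR borel_measurable_indicator)
    show "AE t in lebesgue_rows m. norm (indicator ?D t *\<^sub>R G w t) \<le> norm (indicator ?D t *\<^sub>R C ^ m)"
      using Gbound[OF w] by (intro always_eventually) (auto split: split_indicator intro: order_trans[OF _ abs_ge_self])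
  qed
  show thesis
  proof (rule that[of "\<lambda>w. LINT t:?D|lebesgue_rows m. G w t"])
    fix w assume w: "w \<in> words S m"
    have "\<bar>LINT t:?D|lebesgue_rows m. G w t\<bar> \<le> (LINT t|lebesgue_rows m. \<bar>indicator ?D t *\<^sub>R G w t\<bar>)"
      unfolding set_lebesgue_integral_def by (rule integral_abs_bound)
    also have "\<dots> \<le> (LINT t|lebesgue_rows m. indicator ?D t *\<^sub>R C ^ m)"
      using Gbound[OF w]
      by (intro integral_mono integrable_abs Gint[OF w] Dint) (auto split: split_indicator)
    also have "\<dots> = C ^ m * measure (borel_rows m) ?D"
      using D by (simp add: measure_completion)
    finally show "\<bar>LINT t:?D|lebesgue_rows m. G w t\<bar> \<le> C ^ m * measure (borel_rows m) ?D" .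
  next
    show "has_tensor_integral (lebesgue_rows m) ?D (\<lambda>t. tensor_prod (map (\<lambda>i. g (t i)) ?ks))
        (\<Sum>w\<in>words S m. (LINT t:?D|lebesgue_rows m. G w t) *\<^sub>R tensor_prod (map e w))"
    proof (rule has_tensor_integral_expansion)
      show "set_integrable (lebesgue_rows m) ?D (G w)" if "w \<in> words S m" for w
        using Gint[OF that] by (simp add: set_integrable_def)
      show "AE t in borel_rows m. t \<in> ?D \<longrightarrow>
          tensor_prod (map (\<lambda>i. g (t i)) ?ks) = (\<Sum>w\<in>words S m. G w t *\<^sub>R tensor_prod (map e w))"
        using AE_D_domain[OF rep \<pi>]
      proof (rule eventually_mono, intro impI)
        fix t assume "t \<in> ?D \<longrightarrow> (\<forall>i\<in>{1..m}. g (t i) = (\<Sum>\<phi>\<in>S. c \<phi> (t i) *\<^sub>R e \<phi>))" "t \<in> ?D"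
        then have "g (t i) = (\<Sum>\<phi>\<in>S. c \<phi> (t i) *\<^sub>R e \<phi>)" if "i \<in> set ?ks" for i
          using that by auto
        from tensor_prod_expansion[where u="\<lambda>i. g (t i)" and ks="?ks" and c="\<lambda>i \<phi>. c \<phi> (t i)" and xs="[]", OF S this]
        show "tensor_prod (map (\<lambda>i. g (t i)) ?ks) = (\<Sum>w\<in>words S m. G w t *\<^sub>R tensor_prod (map e w))"
          by (simp add: G_def del: upt_Suc)
      qed
    qed
  qed
qed

text \<open>Exchanging the families transposes the Gram matrix and keeps its determinant;
  bilinearity carries this from wedges to all elements. \<open>tensor_inner\<close> is characterized
  only for symmetric forms.\<close>

lemma ext_inner_commute:
  fixes \<xi> \<eta> :: "('d::finite, 'a::real_inner) ext_power"
  shows "ext_inner \<xi> \<eta> = ext_inner \<eta> \<xi>"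
proof -
  note bil = ext_inner_characterization(1)[where 'd='d and 'a='a]
  have lin: "linear (\<lambda>\<xi>. ext_inner \<xi> \<eta>)" "linear (\<lambda>\<xi>. ext_inner \<eta> \<xi>)"
    for \<eta> :: "('d, 'a) ext_power"
    using bil by (auto simp: bilinear_def)
  have gen: "ext_inner (wedge v) (wedge w) = ext_inner (wedge w) (wedge v)" for v w :: "'d \<Rightarrow> 'a"
  proof -
    have "(\<chi> i j. v i \<bullet> w j) = transpose (\<chi> i j. w i \<bullet> v j)"
      by (simp add: vec_eq_iff transpose_def inner_commute)
    then show ?thesis
      by (simp add: ext_inner_characterization(2) det_transpose)
  qed
  have "(\<lambda>\<xi>. ext_inner \<xi> (wedge w)) = (\<lambda>\<xi>. ext_inner (wedge w) \<xi>)" for w :: "'d \<Rightarrow> 'a"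
    by (rule linear_eq_on_span_UNIV[OF lin span_range_wedge]) (auto simp: gen)
  then have "(\<lambda>\<eta>. ext_inner \<xi> \<eta>) = (\<lambda>\<eta>. ext_inner \<eta> \<xi>)" for \<xi> :: "('d, 'a) ext_power"
    by (intro linear_eq_on_span_UNIV[OF lin(2,1) span_range_wedge]) (auto simp: fun_eq_iff)
  then show ?thesis by metis
qed

lemma sig_component_integral:
  fixes x :: "real^'d::finite \<Rightarrow> 'v::real_inner"
  assumes "finite_dimensional TYPE('v)" "x \<in> lip_maps" "1 \<le> m" "\<pi> \<in> perm_families m"
  shows "has_tensor_integral (lebesgue_rows m) (D_domain m \<pi>)
    (\<lambda>t. tensor_prod (map (\<lambda>i. dhat x (t i)) [1..<Suc m])) (sig_component m \<pi> x)"
proof -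
  obtain I :: "('d \<Rightarrow> 'v) set" and c C where I: "finite I" "0 \<le> C"
    "\<And>\<phi>. \<phi> \<in> I \<Longrightarrow> c \<phi> \<in> borel_measurable borel" "\<And>\<phi> s. \<phi> \<in> I \<Longrightarrow> \<bar>c \<phi> s\<bar> \<le> C"
    "AE s in lborel. s \<in> unit_cube \<longrightarrow> dhat x s = (\<Sum>\<phi>\<in>I. c \<phi> s *\<^sub>R wedge \<phi>)"
    by (rule dhat_representation[OF assms(1,2)]) (rule that)
  obtain a where "has_tensor_integral (lebesgue_rows m) (D_domain m \<pi>)
       (\<lambda>t. tensor_prod (map (\<lambda>i. dhat x (t i)) [1..<Suc m]))
       (\<Sum>w\<in>words I m. a w *\<^sub>R tensor_prod (map wedge w))"
    by (rule signature_integral_expansion[OF assms(3,4) I(1,3,4,5)])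
  moreover from tensor_integral_eqI[OF this]
  have "sig_component m \<pi> x = (\<Sum>w\<in>words I m. a w *\<^sub>R tensor_prod (map wedge w))"
    unfolding sig_component_def .
  ultimately show ?thesis by simp
qed

lemma sig_map_in_H_space:
  fixes x :: "real^'d::finite \<Rightarrow> 'v::real_inner"
  assumes fd: "finite_dimensional TYPE('v)" and x: "x \<in> lip_maps"
  shows "sig_map x \<in> H_space"
proof -
  obtain I :: "('d \<Rightarrow> 'v) set" and c C where I: "finite I" "0 \<le> C"
    "\<And>\<phi>. \<phi> \<in> I \<Longrightarrow> c \<phi> \<in> borel_measurable borel" "\<And>\<phi> s. \<phi> \<in> I \<Longrightarrow> \<bar>c \<phi> s\<bar> \<le> C"
    "AE s in lborel. s \<in> unit_cube \<longrightarrow> dhat x s = (\<Sum>\<phi>\<in>I. c \<phi> s *\<^sub>R wedge \<phi>)"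
    by (rule dhat_representation[OF fd x]) (rule that)
  define vol where "vol m \<pi> = measure (borel_rows m) (D_domain m \<pi>)" for m and \<pi> :: "'d \<Rightarrow> nat \<Rightarrow> nat"
  have expansion: "\<exists>a. (\<forall>w\<in>words I m. \<bar>a w\<bar> \<le> C ^ m * vol m \<pi>) \<and>
      sig_component m \<pi> x = (\<Sum>w\<in>words I m. a w *\<^sub>R tensor_prod (map wedge w))"
    if m\<pi>: "1 \<le> m" "\<pi> \<in> perm_families m" for m \<pi>
  proof -
    obtain a where a: "\<And>w. w \<in> words I m \<Longrightarrow> \<bar>a w\<bar> \<le> C ^ m * measure (borel_rows m) (D_domain m \<pi>)"
      "has_tensor_integral (lebesgue_rows m) (D_domain m \<pi>)
         (\<lambda>t. tensor_prod (map (\<lambda>i. dhat x (t i)) [1..<Suc m]))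
         (\<Sum>w\<in>words I m. a w *\<^sub>R tensor_prod (map wedge w))"
      by (rule signature_integral_expansion[OF m\<pi> I(1,3,4,5)]) (assumption, assumption, rule that)
    from tensor_integral_eqI[OF a(2)] a(1) show ?thesis
      unfolding sig_component_def vol_def by blast
  qed
  have power: "sig_component m \<pi> x \<in> tensor_power m" if m\<pi>: "1 \<le> m" "\<pi> \<in> perm_families m" for m \<pi>
  proof -
    obtain a where a: "sig_component m \<pi> x = (\<Sum>w\<in>words I m. a w *\<^sub>R tensor_prod (map wedge w))"
      using expansion[OF m\<pi>] by blast
    show ?thesis
      unfolding a tensor_power_def
      by (intro span_sum span_scale span_base) (auto simp: words_def)
  qed
  \<comment> \<open>Summing all absolute values bounds each of them, and the definition stays
    meaningful for empty I.\<close>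
  define K where "K = (\<Sum>\<phi>\<in>I. \<Sum>\<psi>\<in>I. \<bar>ext_inner (wedge \<phi>) (wedge \<psi> :: ('d, 'v) ext_power)\<bar>)"
  have K: "\<bar>ext_inner (wedge \<phi>) (wedge \<psi>)\<bar> \<le> K" if "\<phi> \<in> I" "\<psi> \<in> I" for \<phi> \<psi>
  proof -
    have "\<bar>ext_inner (wedge \<phi>) (wedge \<psi>)\<bar> \<le> (\<Sum>\<psi>\<in>I. \<bar>ext_inner (wedge \<phi>) (wedge \<psi>)\<bar>)"
      using that I(1) by (intro member_le_sum) auto
    also have "\<dots> \<le> K"
      unfolding K_def using that I(1)
      by (intro member_le_sum[where f="\<lambda>\<phi>. \<Sum>\<psi>\<in>I. \<bar>ext_inner (wedge \<phi>) (wedge \<psi>)\<bar>"] sum_nonneg) auto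
    finally show ?thesis .
  qed
  have "0 \<le> K" unfolding K_def by (intro sum_nonneg) auto
  define Q where "Q = (real (card I))\<^sup>2 * K * C\<^sup>2"
  have "0 \<le> Q" unfolding Q_def using \<open>0 \<le> K\<close> by simp
  \<comment> \<open>The right-hand side is the general term of the exponential series at Q; level 0
    has squared norm 1, its first term.\<close>
  have level: "\<bar>level_norm_sq (sig_map x) m\<bar> \<le> inverse (fact m) * Q ^ m" for m
  proof (cases "m = 0")
    case True
    then show ?thesis by (simp add: level_norm_sq_def sig_map_def)
  next
    case False
    then have m: "1 \<le> m" by simp
    have comp: "\<bar>tensor_inner ext_inner (sig_component m \<pi> x) (sig_component m \<pi> x)\<bar> \<le> Q ^ m * (vol m \<pi>)\<^sup>2"
      if \<pi>: "\<pi> \<in> perm_families m" for \<pi>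
    proof -
      obtain a where a: "\<And>w. w \<in> words I m \<Longrightarrow> \<bar>a w\<bar> \<le> C ^ m * vol m \<pi>"
        "sig_component m \<pi> x = (\<Sum>w\<in>words I m. a w *\<^sub>R tensor_prod (map wedge w))"
        using expansion[OF m \<pi>] by blast
      have "\<bar>tensor_inner ext_inner (sig_component m \<pi> x) (sig_component m \<pi> x)\<bar> \<le>
          ((real (card I))\<^sup>2 * K) ^ m * (C ^ m * vol m \<pi>)\<^sup>2"
        unfolding a(2)
        by (rule tensor_inner_expansion_bound[OF ext_inner_characterization(1) ext_inner_commute I(1) K a(1)])
      also have "\<dots> = Q ^ m * (vol m \<pi>)\<^sup>2"
        by (simp add: Q_def power_mult_distrib mult_ac flip: power_mult)
      finally show ?thesis .
    qed
    have "level_norm_sq (sig_map x) m =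
        (\<Sum>\<pi>\<in>perm_families m. tensor_inner ext_inner (sig_component m \<pi> x) (sig_component m \<pi> x))"
      using m by (simp add: level_norm_sq_def sig_map_def)
    also have "\<bar>\<dots>\<bar> \<le> (\<Sum>\<pi>\<in>perm_families m. Q ^ m * (vol m \<pi>)\<^sup>2)"
      by (rule order_trans[OF sum_abs]) (intro sum_mono comp)
    also have "\<dots> = Q ^ m * (\<Sum>\<pi>\<in>perm_families m. (vol m \<pi>)\<^sup>2)"
      by (simp add: sum_distrib_left)
    also have "\<dots> \<le> Q ^ m * (1 / fact m)"
      unfolding vol_def using \<open>0 \<le> Q\<close> by (intro mult_left_mono sum_measure_D_domain_sq_le m) auto
    finally show ?thesis by (simp add: field_simps)
  qed
  have "summable (level_norm_sq (sig_map x))"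
    by (rule summable_comparison_test'[OF summable_exp[of Q], of 0]) (use level in simp)
  then show ?thesis
    unfolding H_space_def using power by (simp add: sig_map_def)
qed

lemma sig_map_cong:
  fixes x y :: "real^'d::finite \<Rightarrow> 'v::real_inner"
  assumes fd: "finite_dimensional TYPE('v)" and xy: "(x, y) \<in> jac_rel"
  shows "sig_map x = sig_map y"
proof -
  have x: "x \<in> lip_maps" and ae: "AE s in lborel. s \<in> unit_cube \<longrightarrow> dhat x s = dhat y s"
    using xy by (auto simp: jac_rel_def AE_lebesgue_on_cube)
  have "sig_component m \<pi> y = sig_component m \<pi> x" if m: "1 \<le> m" and \<pi>: "\<pi> \<in> perm_families m" for m \<pi>
    unfolding sig_component_def[of m \<pi> y]
  proof (rule tensor_integral_eqI, rule has_tensor_integral_cong_AE[OF sig_component_integral[OF fd x m \<pi>]])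
    show "AE t in borel_rows m. t \<in> D_domain m \<pi> \<longrightarrow>
        tensor_prod (map (\<lambda>i. dhat x (t i)) [1..<Suc m]) = tensor_prod (map (\<lambda>i. dhat y (t i)) [1..<Suc m])"
      using AE_D_domain[OF ae \<pi>]
      by (rule eventually_mono) (auto intro!: arg_cong[where f=tensor_prod] map_cong)
  qed
  then show ?thesis
    by (simp add: sig_map_def fun_eq_iff)
qed

text \<open>\<open>tensor_map\<close> of the integrand for x agrees almost everywhere on the domain
  with the integrand for A \<circ> x, and integration commutes with linear maps.\<close>

lemma sig_map_linear_image:
  fixes A :: "'v::real_inner \<Rightarrow> 'w::real_inner" and x :: "real^'d::finite \<Rightarrow> 'v"
  assumes fd: "finite_dimensional TYPE('v)" and A: "linear A" and x: "x \<in> lip_maps"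
  shows "sig_map (A \<circ> x) = induced_map A (sig_map x)"
proof -
  let ?E = "ext_map A :: ('d, 'v) ext_power \<Rightarrow> ('d, 'w) ext_power"
  have E: "linear ?E" by (rule ext_map_characterization[OF A])
  note T = tensor_map_characterization[OF E]
  have ae: "AE s in lborel. s \<in> unit_cube \<longrightarrow> dhat (A \<circ> x) s = ?E (dhat x s)"
    using dhat_linear_image[OF fd A x] by (simp add: AE_lebesgue_on_cube)
  have "sig_component m \<pi> (A \<circ> x) = tensor_map ?E (sig_component m \<pi> x)"
    if m: "1 \<le> m" and \<pi>: "\<pi> \<in> perm_families m" for m \<pi>
    unfolding sig_component_def[of m \<pi> "A \<circ> x"]
  proof (rule tensor_integral_eqI, rule has_tensor_integral_cong_AE[OF
      has_tensor_integral_linear_image[OF sig_component_integral[OF fd x m \<pi>] T(1)]])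
    show "AE t in borel_rows m. t \<in> D_domain m \<pi> \<longrightarrow>
        tensor_map ?E (tensor_prod (map (\<lambda>i. dhat x (t i)) [1..<Suc m])) =
        tensor_prod (map (\<lambda>i. dhat (A \<circ> x) (t i)) [1..<Suc m])"
      using AE_D_domain[OF ae \<pi>]
      by (rule eventually_mono) (auto simp: T(2) intro!: arg_cong[where f=tensor_prod] map_cong)
  qed
  \<comment> \<open>This covers the entries for irrelevant m and \<pi>, which are 0 by convention on
    both sides.\<close>
  moreover have "tensor_map ?E 0 = 0"
    by (rule linear_0[OF T(1)])
  ultimately show ?thesis
    by (simp add: sig_map_def induced_map_def fun_eq_iff)
qed

section \<open>Passage to Jacobian equivalence classes\<close>

lemma equiv_jac_rel: "equiv lip_maps jac_rel"
proof (rule equivI)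
  show "sym jac_rel"
    by (rule symI) (auto simp: jac_rel_def elim: eventually_mono)
  show "trans jac_rel"
    by (rule transI) (auto simp: jac_rel_def elim: eventually_elim2)
qed (auto simp: jac_rel_def refl_on_def)

text \<open>\<open>the_elem\<close> needs a singleton: the class contains x, and
  \<open>sig_map\<close> is constant on it.\<close>

lemma signature_class:
  fixes x :: "real^'d::finite \<Rightarrow> 'v::real_inner"
  assumes "finite_dimensional TYPE('v)" "x \<in> lip_maps"
  shows "signature (jac_rel `` {x}) = sig_map x"
proof -
  have "x \<in> jac_rel `` {x}"
    by (rule equiv_class_self[OF equiv_jac_rel assms(2)])
  moreover have "sig_map y = sig_map x" if "y \<in> jac_rel `` {x}" for y
    using sig_map_cong[OF assms(1), of x y] that by simp
  ultimately have "sig_map ` (jac_rel `` {x}) = {sig_map x}"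
    by blast
  then show ?thesis by (simp add: signature_def)
qed

text \<open>The Jacobian of A \<circ> y depends, almost everywhere, only on that of y, so all
  representatives give the same class and the union in \<open>lip_J_map\<close> collapses.\<close>

lemma lip_J_map_class:
  fixes A :: "'v::real_inner \<Rightarrow> 'w::real_inner" and x :: "real^'d::finite \<Rightarrow> 'v"
  assumes fd: "finite_dimensional TYPE('v)" and A: "linear A" and x: "x \<in> lip_maps"
  shows "lip_J_map A (jac_rel `` {x}) = jac_rel `` {A \<circ> x}"
proof -
  have "jac_rel `` {A \<circ> y} = jac_rel `` {A \<circ> x}" if "(x, y) \<in> jac_rel" for y
  proof (rule equiv_class_eq[OF equiv_jac_rel])
    have y: "y \<in> lip_maps" and ae: "AE s in lebesgue_on unit_cube. dhat x s = dhat y s"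
      using that by (auto simp: jac_rel_def)
    have "AE s in lebesgue_on unit_cube. dhat (A \<circ> y) s = dhat (A \<circ> x) s"
      using ae dhat_linear_image[OF fd A x] dhat_linear_image[OF fd A y]
      by eventually_elim simp
    then show "(A \<circ> y, A \<circ> x) \<in> jac_rel"
      using lip_maps_linear_image[OF fd A x] lip_maps_linear_image[OF fd A y] by (simp add: jac_rel_def)
  qed
  moreover have "x \<in> jac_rel `` {x}"
    by (rule equiv_class_self[OF equiv_jac_rel x])
  ultimately show ?thesis
    unfolding lip_J_map_def by blast
qed

theorem proposition7:
  fixes A :: "'v::real_inner \<Rightarrow> 'w::real_inner"
    and X :: "(real^'d::finite \<Rightarrow> 'v) set"
  assumes "finite_dimensional TYPE('v)" and "finite_dimensional TYPE('w)"
    and "linear A"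
    and "X \<in> lip_J"
  shows "signature X \<in> H_space \<and> signature (lip_J_map A X) \<in> H_space \<and>
    signature (lip_J_map A X) = induced_map A (signature X)"
proof -
  obtain x where x: "x \<in> lip_maps" and X: "X = jac_rel `` {x}"
    using assms(4) unfolding lip_J_def by (rule quotientE)
  have Ax: "A \<circ> x \<in> lip_maps"
    by (rule lip_maps_linear_image[OF assms(1,3) x])
  \<comment> \<open>Square summability of the second signature comes from A \<circ> x being a
    Lipschitz map into a finite-dimensional space, independently of
    \<open>induced_map\<close>.\<close>
  show ?thesis
    unfolding X lip_J_map_class[OF assms(1,3) x] signature_class[OF assms(1) x]
      signature_class[OF assms(2) Ax]
    using sig_map_in_H_space[OF assms(1) x] sig_map_in_H_space[OF assms(2) Ax]
      sig_map_linear_image[OF assms(1,3) x] by blast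
qed

end
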